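(* Let $\mathcal{S}_{\mathcal{G}}'\subseteq\mathcal{V}_{\mathcal{G}}$ with $|\mathcal{S}_{\mathcal{G}}'|=B_{\mathcal{G}}$ and $\operatorname{rank}(\mathbf{U}_{\mathcal{G}}(\mathcal{S}_{\mathcal{G}}',\mathcal{I}))=B_{\mathcal{G}}$. Let $\mathcal{S}\subseteq\mathcal{S}_{\mathcal{G}}'\times\mathbb{R}$ be a stable sampling set for the signals $\mathbf{X}(\mathcal{S}_{\mathcal{G}}',\cdot)$, $\mathbf{X}\in\mathcal{BL}_C(\{\mathcal{F}_1,\dots,\mathcal{F}_{B_{\mathcal{G}}}\})$, with joint bandwidth $B$. For $\Theta\subseteq\mathcal{S}_{\mathcal{G}}'$, let $\mathcal{S}_\Theta=\{(v,t)\in\mathcal{S}:v\in\Theta\}$ and $\Theta^c=\mathcal{S}_{\mathcal{G}}'\setminus\Theta$. Then $$D(\mathcal{S}_\Theta)\ \ge\ \frac1N\left(B-\int_{\mathcal{F}}\operatorname{rank}\big(\mathbf{U}_{\mathcal{G}}(\Theta^c,\mathcal{I}_f)\big)\,df\right).$$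
   Context: Let $\mathcal{G}=(\mathcal{V}_{\mathcal{G}},\mathcal{E}_{\mathcal{G}},\mathbf{W}_{\mathcal{G}})$ be an undirected weighted graph with vertex set $\mathcal{V}_{\mathcal{G}}=\{v_1,\dots,v_N\}$, Laplacian $\mathbf{L}_{\mathcal{G}}=\mathbf{U}_{\mathcal{G}}\mathbf{\Lambda}_{\mathcal{G}}\mathbf{U}_{\mathcal{G}}^H$ with $\mathbf{U}_{\mathcal{G}}$ orthonormal with columns $\mathbf{u}_i$; $\mathbf{U}_{\mathcal{G}}(A,C)$ denotes the submatrix with rows $A$ and columns $C$. A CTVGS is $\mathbf{X}=(\mathbf{X}(v,\cdot))_{v\in\mathcal{V}_{\mathcal{G}}}$ with $\mathbf{X}(v,\cdot)\in L^2(\mathbb{R})$; $\mathcal{F}_{FT}(\mathbf{X})(v,f)=\int\mathbf{X}(v,t)e^{-j2\pi ft}dt$; JFT $\mathcal{F}_{\mathcal{J}}(\mathbf{X})(i,f)=\sum_v\mathbf{u}_i(v)\mathcal{F}_{FT}(\mathbf{X})(v,f)$. $\mathcal{F}_i$ (finite union of intervals) is the support of $\mathcal{F}_{\mathcal{J}}(\mathbf{X})(i,\cdot)$, $\mathcal{I}_f=\{i:f\in\mathcal{F}_i\}$, $\mathcal{F}=\bigcup_i\mathcal{F}_i$, $\mathcal{I}=\bigcup_f\mathcal{I}_f$, $B_{\mathcal{G}}=|\mathcal{I}|$, joint bandwidth $B=\sum_i\mu(\mathcal{F}_i)<\infty$ ($\mu$ Lebesgue measure). $\mathcal{BL}_C(\{\mathcal{F}_1,\dots,\mathcal{F}_{B_{\mathcal{G}}}\})$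 is the space of CTVGS with $\mathcal{F}_{\mathcal{J}}(\mathbf{X})(i,f)=0$ for $f\notin\mathcal{F}_i$ (values on $\mathcal{F}_i$ arbitrary). A sampling set is a set $\mathcal{S}$ of pairs $(v,t)$ such that each $\mathcal{S}_v=\{t:(v,t)\in\mathcal{S}\}$ is discrete. It is stable for a class $\Gamma$ of signals if there are constants $0<A\le A'<\infty$ with $A\|\mathbf{X}\|^2\le\sum_{(v,t)\in\mathcal{S}}|\mathbf{X}(v,t)|^2\le A'\|\mathbf{X}\|^2$ for all $\mathbf{X}\in\Gamma$, where $\|\mathbf{X}\|^2=\sum_v\|\mathbf{X}(v,\cdot)\|_{L^2}^2$. Densities: for a single vertex, $D(\mathcal{S}_v)=\liminf_{t\to\infty}|\mathcal{S}_v\cap[-t,t]|/(2t)$; for a subset $\mathcal{S}_\Theta$ or the whole set, $D(\mathcal{S}_\Theta)=\liminf_{t\to\infty}|\mathcal{S}_\Theta\cap(\mathcal{V}_{\mathcal{G}}\times[-t,t])|/(2tN)$. *)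

theory Defs
  imports "HOL-Analysis.Analysis" "Jordan_Normal_Form.DL_Rank_Submatrix"
begin

definition mat_rank :: "complex mat \<Rightarrow> nat" where
  "mat_rank M = vec_space.rank (dim_row M) M"

(* The N x N matrix U_G built from U (rows = vertices, columns = eigen-indices);
   U_G(A,C) is the submatrix with rows A and columns C. *)
definition Umat :: "nat \<Rightarrow> (nat \<Rightarrow> nat \<Rightarrow> complex) \<Rightarrow> complex mat" where
  "Umat N U = mat N N (\<lambda>(v, i). U v i)"

definition Usub :: "nat \<Rightarrow> (nat \<Rightarrow> nat \<Rightarrow> complex) \<Rightarrow> nat set \<Rightarrow> nat set \<Rightarrow> complex mat" where
  "Usub N U A C = submatrix (Umat N U) A C"

definition laplacian :: "nat \<Rightarrow> (nat \<Rightarrow> nat \<Rightarrow> real) \<Rightarrow> nat \<Rightarrow> nat \<Rightarrow> real" where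
  "laplacian N W v w = (if v = w then (\<Sum>u<N. W v u) else 0) - W v w"

definition undirected_weighted_graph :: "nat \<Rightarrow> (nat \<Rightarrow> nat \<Rightarrow> real) \<Rightarrow> bool" where
  "undirected_weighted_graph N W \<longleftrightarrow>
     (\<forall>v<N. \<forall>w<N. W v w = W w v \<and> W v w \<ge> 0) \<and> (\<forall>v<N. W v v = 0)"

definition laplacian_eigendecomp ::
  "nat \<Rightarrow> (nat \<Rightarrow> nat \<Rightarrow> real) \<Rightarrow> (nat \<Rightarrow> nat \<Rightarrow> complex) \<Rightarrow> (nat \<Rightarrow> real) \<Rightarrow> bool" where
  "laplacian_eigendecomp N W U lam \<longleftrightarrow>
     (\<forall>i<N. \<forall>k<N. (\<Sum>v<N. cnj (U v i) * U v k) = (if i = k then 1 else 0)) \<and>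
     (\<forall>v<N. \<forall>w<N. complex_of_real (laplacian N W v w) =
        (\<Sum>i<N. U v i * complex_of_real (lam i) * cnj (U w i)))"

definition finite_union_of_intervals :: "real set \<Rightarrow> bool" where
  "finite_union_of_intervals S \<longleftrightarrow>
     (\<exists>\<K>. finite \<K> \<and> (\<forall>K\<in>\<K>. is_interval K) \<and> S = \<Union>\<K>)"

(* The space BL_C({F_1,...,F_N}): CTVGS X (vertex v, time t) whose joint Fourier
   transform JFT(X)(i,.) vanishes outside F_i.  Since the Fourier transform of
   X(v,.) is X^(v,f) = sum_i cnj(u_i(v)) JFT(X)(i,f) (inverse of the unitary U^T),
   and JFT(X)(i,.) is an arbitrary L^2 function supported in F_i (finite measure),
   such X are exactly the (continuous versions of the) inverse Fourier transforms
   below, with g i = JFT(X)(i,.) restricted to F_i. *)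
definition BL_C :: "nat \<Rightarrow> (nat \<Rightarrow> nat \<Rightarrow> complex) \<Rightarrow> (nat \<Rightarrow> real set)
                    \<Rightarrow> (nat \<Rightarrow> real \<Rightarrow> complex) set" where
  "BL_C N U F = {X. \<exists>g :: nat \<Rightarrow> real \<Rightarrow> complex.
       (\<forall>i<N. g i \<in> borel_measurable lborel \<and>
              set_integrable lborel (F i) (\<lambda>f. (cmod (g i f))\<^sup>2)) \<and>
       (\<forall>v t. X v t = (\<Sum>i<N. cnj (U v i) *
                 (LINT f:F i|lborel. g i f * cis (2 * pi * f * t))))}"

definition sig_norm2 :: "nat set \<Rightarrow> (nat \<Rightarrow> real \<Rightarrow> complex) \<Rightarrow> real" where
  "sig_norm2 Vs X = (\<Sum>v\<in>Vs. LINT t|lborel. (cmod (X v t))\<^sup>2)"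

definition sampling_set :: "(nat \<times> real) set \<Rightarrow> bool" where
  "sampling_set S \<longleftrightarrow> (\<forall>v. \<forall>T::real. finite {t. (v, t) \<in> S \<and> -T \<le> t \<and> t \<le> T})"

definition stable_sampling :: "(nat \<times> real) set \<Rightarrow> nat set \<Rightarrow> (nat \<Rightarrow> real \<Rightarrow> complex) set \<Rightarrow> bool" where
  "stable_sampling S Vs \<Gamma> \<longleftrightarrow> sampling_set S \<and>
     (\<exists>A A'. 0 < A \<and> A \<le> A' \<and>
        (\<forall>X\<in>\<Gamma>. (\<lambda>(v, t). (cmod (X v t))\<^sup>2) summable_on S \<and>
           A * sig_norm2 Vs X \<le> (\<Sum>\<^sub>\<infinity>(v, t)\<in>S. (cmod (X v t))\<^sup>2) \<and>
           (\<Sum>\<^sub>\<infinity>(v, t)\<in>S. (cmod (X v t))\<^sup>2) \<le> A' * sig_norm2 Vs X))"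

definition density :: "nat \<Rightarrow> (nat \<times> real) set \<Rightarrow> ereal" where
  "density N S = Liminf at_top
     (\<lambda>T::real. ereal (real (card {(v, t) \<in> S. v < N \<and> -T \<le> t \<and> t \<le> T}) / (2 * T * real N)))"

end

theory Submission
  imports Defs "HOL-Probability.Probability"
begin

text \<open>
  Cut the frequency axis into cells of length \<open>d\<close>; all but boundedly many cells lie inside or outside
  each \<open>F i\<close>. On a good cell \<open>q\<close>, with \<open>I q\<close> the set of those \<open>i\<close> whose band contains it, place the
  spectra \<open>bump * exp(-2 \<pi> i f k / l)\<close>, where \<open>l < d\<close> is close to \<open>d\<close> and \<open>\<bar>k\<bar> / l \<le> w T\<close> with \<open>w < 1\<close>;
  in time these are atoms centred at \<open>k / l\<close> and decaying quadratically. Their combinations form a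
  space of dimension about \<open>2 w l T \<Sum>q. card (I q)\<close>. Vanishing on \<open>\<Theta>\<^sup>c\<close> costs at most
  \<open>2 w l T \<Sum>q. rank U(\<Theta>\<^sup>c, I q)\<close> linear equations, and vanishing at the samples of \<open>\<Theta>\<close> in \<open>[-T, T]\<close>
  costs one equation per sample. With too few samples a nonzero combination is left whose samples
  all lie beyond \<open>T\<close>, at distance at least \<open>(1 - w) T\<close> from all centres. The upper frame bound limits the number of
  samples per unit interval, so their energy is \<open>O(1 / T)\<close> relative to the coefficients, whereas the
  exponentials are orthogonal on an interval of length \<open>l\<close> inside the cell, so that the lower frame
  bound, together with Plancherel's inequality and the left inverse of \<open>U(S', I)\<close>, makes the energy
  at least a constant multiple of them: a contradiction for large \<open>T\<close>.
\<close>

subsection \<open>Linear algebra\<close>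

text \<open>Gaussian elimination by induction on the equations. An equation whose coefficients all
  vanish is dropped; any other is solved for one unknown, which lowers both counts by one.\<close>

lemma underdetermined_system:
  fixes a :: "'e \<Rightarrow> 'u \<Rightarrow> 'a :: field"
  assumes "finite E" "finite U" "card E < card U"
  shows "\<exists>x. (\<exists>u\<in>U. x u \<noteq> 0) \<and> (\<forall>e\<in>E. (\<Sum>u\<in>U. a e u * x u) = 0)"
  using assms
proof (induction E arbitrary: U a rule: finite_induct)
  case empty
  then have "U \<noteq> {}" by auto
  then show ?case by (intro exI[of _ "\<lambda>_. 1"]) auto
next
  case (insert e E)
  show ?case
  proof (cases "\<forall>u\<in>U. a e u = 0")
    case True
    have "card E < card U" using insert by simp
    from insert.IH[OF insert.prems(1) this, of a] obtain x where
      "\<exists>u\<in>U. x u \<noteq> 0" "\<forall>e'\<in>E. (\<Sum>u\<in>U. a e' u * x u) = 0" by blast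
    with True show ?thesis by (intro exI[of _ x]) simp
  next
    case False
    then obtain w where w: "w \<in> U" "a e w \<noteq> 0" by blast
    \<comment> \<open>The coefficients left after the unknown \<open>w\<close> has been eliminated
      with the pivot \<open>a e w\<close>.\<close>
    define b where "b e' u = a e' u - a e' w * a e u / a e w" for e' u
    have c: "card E < card (U - {w})" using insert w by auto
    have fU: "finite (U - {w})" using insert by auto
    from insert.IH[OF fU c, of b] obtain y where
      y: "\<exists>u\<in>U - {w}. y u \<noteq> 0" "\<forall>e'\<in>E. (\<Sum>u\<in>U - {w}. b e' u * y u) = 0" by blast
    \<comment> \<open>The value that equation \<open>e\<close> forces on the unknown
      \<open>w\<close> once the others are fixed as \<open>y\<close>.\<close>
    define z where "z = - (\<Sum>u\<in>U - {w}. a e u * y u) / a e w"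
    define x where "x = y(w := z)"
    have split: "(\<Sum>u\<in>U. a e' u * x u) = a e' w * z + (\<Sum>u\<in>U - {w}. a e' u * y u)" for e'
      using insert.prems(1) w by (subst sum.remove[of _ w]) (auto simp: x_def intro!: sum.cong)
    have "(\<Sum>u\<in>U. a e' u * x u) = 0" if "e' \<in> insert e E" for e'
    proof (cases "e' = e")
      case True
      then show ?thesis using w split[of e] by (simp add: z_def)
    next
      case False
      with that have "e' \<in> E" by auto
      then have "0 = (\<Sum>u\<in>U - {w}. b e' u * y u)" using y by auto
      also have "\<dots> = (\<Sum>u\<in>U - {w}. a e' u * y u) - (\<Sum>u\<in>U - {w}. a e' w / a e w * (a e u * y u))"
        by (simp add: b_def left_diff_distrib sum_subtractf mult.assoc)
      also have "\<dots> = (\<Sum>u\<in>U - {w}. a e' u * y u) - a e' w / a e w * (\<Sum>u\<in>U - {w}. a e u * y u)"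
        by (simp only: sum_distrib_left mult.assoc)
      also have "\<dots> = (\<Sum>u\<in>U. a e' u * x u)" unfolding split z_def by simp
      finally show ?thesis by simp
    qed
    moreover have "\<exists>u\<in>U. x u \<noteq> 0" using y(1) by (auto simp: x_def)
    ultimately show ?thesis by blast
  qed
qed

text \<open>The rank is the size of a maximal independent set of columns, and by maximality every
  column is a combination of these. Read entrywise, this factors the matrix through a space whose
  dimension is the rank.\<close>

lemma column_rank_factorization:
  fixes A :: "'a :: field mat"
  assumes A: "A \<in> carrier_mat n nc"
  shows "\<exists>B R. \<forall>a<n. \<forall>i<nc. A $$ (a, i) = (\<Sum>j<vec_space.rank n A. B a j * R j i)"
proof -
  interpret vec_space "TYPE('a)" n .
  have C: "set (cols A) \<subseteq> carrier_vec n" using cols_dim A by blast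
  have "\<exists>S. finite S \<and> maximal S (\<lambda>T. T \<subseteq> set (cols A) \<and> lin_indpt T) \<and> {} \<subseteq> S"
    by (rule maximal_exists_superset[of "set (cols A)"]) (auto simp: lin_dep_def)
  then obtain S where S: "finite S" "maximal S (\<lambda>T. T \<subseteq> set (cols A) \<and> lin_indpt T)" by blast
  have r: "rank A = card S" by (rule rank_card_indpt[OF A S(2)])
  have SC: "S \<subseteq> set (cols A)" and ind: "lin_indpt S" using S(2) by (auto simp: maximal_def)
  have SCn: "S \<subseteq> carrier_vec n" using SC C by auto
  \<comment> \<open>A column outside the span of \<open>S\<close> could be added to \<open>S\<close>
    without losing independence.\<close>
  have sp: "c \<in> span S" if c: "c \<in> set (cols A)" for c
  proof (rule ccontr)
    assume n: "c \<notin> span S"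
    then have cS: "c \<notin> S" using span_mem[OF SCn] by auto
    have "c \<in> carrier_vec n" using c C by auto
    then have "lin_indpt (S \<union> {c})" using lin_dep_iff_in_span[OF SCn ind _ cS] n by auto
    then show False using S(2) c SC cS unfolding maximal_def by (metis Un_subset_iff empty_subsetI insert_subset sup.cobounded1 UnI2 insertI1)
  qed
  have "\<forall>c\<in>set (cols A). \<exists>a. c = lincomb a S"
    using sp finite_span[OF S(1) SCn] by auto
  then obtain f where f: "\<And>c. c \<in> set (cols A) \<Longrightarrow> c = lincomb (f c) S" by metis
  obtain g where g: "bij_betw g {..<card S} S"
    using ex_bij_betw_nat_finite[OF S(1)] by (auto simp: atLeast0LessThan)
  show ?thesis unfolding r
  proof (intro exI allI impI)
    fix a i assume ai: "a < n" "i < nc"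
    have ci: "col A i \<in> set (cols A)" using ai A by (auto simp: cols_def)
    have "A $$ (a, i) = col A i $ a" using ai A by simp
    also have "\<dots> = (\<Sum>x\<in>S. f (col A i) x * x $ a)"
      by (subst f[OF ci]) (rule lincomb_index[OF ai(1) SCn])
    also have "\<dots> = (\<Sum>j<card S. f (col A i) (g j) * (g j) $ a)"
      by (rule sum.reindex_bij_betw[OF g, symmetric])
    finally show "A $$ (a, i) = (\<Sum>j<card S. (g j $ a) * f (col A i) (g j))"
      by (simp add: mult.commute)
  qed
qed

section \<open>Submatrices of the eigenvector matrix\<close>

lemma Usub_dims:
  assumes "A \<subseteq> {..<N}" "C \<subseteq> {..<N}"
  shows "Usub N U A C \<in> carrier_mat (card A) (card C)"
proof -
  have "{i. i < N \<and> i \<in> A} = A" "{i. i < N \<and> i \<in> C} = C" using assms by auto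
  then show ?thesis by (auto simp: Usub_def Umat_def submatrix_def)
qed

text \<open>\<open>submatrix\<close> renumbers the kept rows and columns from 0, so a vertex
  \<open>v\<close> sits in the row given by the number of elements of \<open>A\<close> below it, and
  similarly for columns.\<close>

lemma Usub_index:
  assumes "A \<subseteq> {..<N}" "C \<subseteq> {..<N}" "v \<in> A" "i \<in> C"
  shows "Usub N U A C $$ (card {a\<in>A. a < v}, card {a\<in>C. a < i}) = U v i"
proof -
  have "v < N" "i < N" using assms by auto
  then show ?thesis
    unfolding Usub_def using assms(3,4) by (subst submatrix_index_card) (simp_all add: Umat_def)
qed

text \<open>Translates between vertices or eigen-indices and the row and column numbers of a
  submatrix.\<close>

lemma card_less_bij:
  fixes A :: "nat set"
  assumes "finite A"
  shows "bij_betw (\<lambda>v. card {a\<in>A. a < v}) A {..<card A}"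
proof -
  have mono: "card {a\<in>A. a < v} < card {a\<in>A. a < w}" if "v \<in> A" "v < w" for v w
    using assms that by (intro psubset_card_mono) auto
  have inj: "inj_on (\<lambda>v. card {a\<in>A. a < v}) A"
    by (rule linorder_inj_onI') (use mono in force)
  have "(\<lambda>v. card {a\<in>A. a < v}) ` A \<subseteq> {..<card A}"
    using assms by (auto intro!: psubset_card_mono)
  moreover have "card ((\<lambda>v. card {a\<in>A. a < v}) ` A) = card {..<card A}"
    using inj by (simp add: card_image)
  ultimately have "(\<lambda>v. card {a\<in>A. a < v}) ` A = {..<card A}"
    by (intro card_subset_eq) auto
  then show ?thesis using inj by (simp add: bij_betw_def)
qed

text \<open>If the submatrix factors as \<open>B R\<close> through its rank, then
  \<open>R x = 0\<close> already forces it to annihilate \<open>x\<close>. This is why vanishing on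
  \<open>A\<close> is paid for by a rank and not by the number of vertices.\<close>

lemma rank_many_equations:
  assumes "A \<subseteq> {..<N}" "C \<subseteq> {..<N}"
  shows "\<exists>R. \<forall>x. (\<forall>j<mat_rank (Usub N U A C). (\<Sum>i\<in>C. R j i * x i) = 0) \<longrightarrow>
           (\<forall>v\<in>A. (\<Sum>i\<in>C. U v i * x i) = 0)"
proof -
  let ?M = "Usub N U A C"
  note M = Usub_dims[OF assms, of U]
  have fin: "finite A" "finite C" using assms finite_subset by blast+
  from column_rank_factorization[OF M] M obtain B R where
    BR: "\<And>a i. a < card A \<Longrightarrow> i < card C \<Longrightarrow> ?M $$ (a, i) = (\<Sum>j<mat_rank ?M. B a j * R j i)"
    unfolding mat_rank_def by auto
  let ?p = "\<lambda>v. card {a\<in>A. a < v}" and ?q = "\<lambda>i. card {a\<in>C. a < i}"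
  show ?thesis
  proof (intro exI allI impI ballI)
    fix x v
    assume x: "\<forall>j<mat_rank ?M. (\<Sum>i\<in>C. R j (?q i) * x i) = 0" and v: "v \<in> A"
    have U: "U v i = (\<Sum>j<mat_rank ?M. B (?p v) j * R j (?q i))" if "i \<in> C" for i
    proof -
      have "?p v < card A" "?q i < card C"
        using card_less_bij[OF fin(1)] card_less_bij[OF fin(2)] v that by (auto simp: bij_betw_def)
      from BR[OF this] Usub_index[OF assms v that] show ?thesis by simp
    qed
    have "(\<Sum>i\<in>C. U v i * x i) = (\<Sum>i\<in>C. \<Sum>j<mat_rank ?M. B (?p v) j * (R j (?q i) * x i))"
      by (intro sum.cong) (simp_all add: U sum_distrib_right mult.assoc)
    also have "\<dots> = (\<Sum>j<mat_rank ?M. B (?p v) j * (\<Sum>i\<in>C. R j (?q i) * x i))"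
      by (subst sum.swap) (simp add: sum_distrib_left)
    also have "\<dots> = 0" using x by simp
    finally show "(\<Sum>i\<in>C. U v i * x i) = 0" .
  qed
qed

text \<open>A square matrix of full rank has nonzero determinant, and its adjugate divided by the
  determinant inverts it. \<open>L\<close> will recover the spectra from their mixtures at the
  vertices.\<close>

lemma full_rank_left_inverse:
  assumes "A \<subseteq> {..<N}" "C \<subseteq> {..<N}"
    and card: "card A = card C" and rank: "mat_rank (Usub N U A C) = card C"
  shows "\<exists>L. \<forall>x. \<forall>i\<in>C. x i = (\<Sum>v\<in>A. L i v * (\<Sum>k\<in>C. U v k * x k))"
proof -
  let ?M = "Usub N U A C" and ?n = "card C"
  have M: "?M \<in> carrier_mat ?n ?n" using Usub_dims[OF assms(1,2), of U] card by simp
  have fin: "finite A" "finite C" using assms finite_subset by blast+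
  have "det ?M \<noteq> 0"
    using vec_space.det_rank_iff[OF M] rank M by (simp add: mat_rank_def)
  define L where "L = (1 / det ?M) \<cdot>\<^sub>m adj_mat ?M"
  have L: "L \<in> carrier_mat ?n ?n" "L * ?M = 1\<^sub>m ?n"
  proof -
    show "L \<in> carrier_mat ?n ?n" using adj_mat(1)[OF M] by (simp add: L_def)
    have "L * ?M = (1 / det ?M) \<cdot>\<^sub>m (det ?M \<cdot>\<^sub>m 1\<^sub>m ?n)"
      unfolding L_def by (simp add: mult_smult_assoc_mat[OF adj_mat(1)[OF M] M] adj_mat(3)[OF M])
    also have "\<dots> = 1\<^sub>m ?n" using \<open>det ?M \<noteq> 0\<close> by (intro eq_matI) auto
    finally show "L * ?M = 1\<^sub>m ?n" .
  qed
  let ?p = "\<lambda>v. card {a\<in>A. a < v}" and ?q = "\<lambda>i. card {a\<in>C. a < i}"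
  have bp: "bij_betw ?p A {..<?n}" using card_less_bij[OF fin(1)] card by simp
  have bq: "bij_betw ?q C {..<?n}" using card_less_bij[OF fin(2)] by simp
  have LU: "(\<Sum>v\<in>A. L $$ (?q i, ?p v) * U v k) = (if i = k then 1 else 0)"
    if i: "i \<in> C" and k: "k \<in> C" for i k
  proof -
    have q: "?q i < ?n" "?q k < ?n" using bq i k by (auto simp: bij_betw_def)
    have "(\<Sum>v\<in>A. L $$ (?q i, ?p v) * U v k) = (\<Sum>v\<in>A. L $$ (?q i, ?p v) * ?M $$ (?p v, ?q k))"
      by (intro sum.cong refl) (simp add: Usub_index[OF assms(1,2) _ k])
    also have "\<dots> = (\<Sum>a<?n. L $$ (?q i, a) * ?M $$ (a, ?q k))"
      by (rule sum.reindex_bij_betw[OF bp, of "\<lambda>a. L $$ (?q i, a) * ?M $$ (a, ?q k)"])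
    also have "\<dots> = (L * ?M) $$ (?q i, ?q k)"
      using q L(1) M by (simp add: scalar_prod_def atLeast0LessThan)
    also have "\<dots> = (if ?q i = ?q k then 1 else 0)" using q by (simp add: L(2))
    also have "?q i = ?q k \<longleftrightarrow> i = k" using bq i k by (auto simp: bij_betw_def inj_on_def)
    finally show ?thesis .
  qed
  show ?thesis
  proof (intro exI allI ballI)
    fix x i assume i: "i \<in> C"
    have "(\<Sum>v\<in>A. L $$ (?q i, ?p v) * (\<Sum>k\<in>C. U v k * x k))
        = (\<Sum>k\<in>C. (\<Sum>v\<in>A. L $$ (?q i, ?p v) * U v k) * x k)"
      by (simp add: sum_distrib_left sum_distrib_right mult.assoc) (rule sum.swap)
    also have "\<dots> = (\<Sum>k\<in>C. if i = k then x k else 0)"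
      by (intro sum.cong) (auto simp: LU[OF i])
    also have "\<dots> = x i" using i fin by simp
    finally show "x i = (\<Sum>v\<in>A. L $$ (?q i, ?p v) * (\<Sum>k\<in>C. U v k * x k))" ..
  qed
qed

subsection \<open>Fourier transforms of integrable functions\<close>

text \<open>The exponent carries a plus sign, as in the kernel of \<open>BL_C\<close>: the transform
  leads from a spectrum to a signal in time.\<close>

definition FT :: "(real \<Rightarrow> complex) \<Rightarrow> real \<Rightarrow> complex" where
  "FT a t = (LINT f|lborel. a f * cis (2 * pi * f * t))"

lemma cis_measurable [measurable]: "cis \<in> borel_measurable borel"
  by (intro borel_measurable_continuous_onI) (auto intro!: continuous_intros)

lemma FT_measurable [measurable]:
  assumes [measurable]: "a \<in> borel_measurable borel"
  shows "FT a \<in> borel_measurable borel"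
  unfolding FT_def[abs_def] by measurable

lemma integrable_cis_mult:
  assumes "integrable lborel a"
  shows "integrable lborel (\<lambda>f. a f * cis (c * f))"
proof (rule Bochner_Integration.integrable_bound[OF assms])
  have [measurable]: "a \<in> borel_measurable borel" using assms by simp
  show "(\<lambda>f. a f * cis (c * f)) \<in> borel_measurable lborel" by measurable
qed (auto simp: norm_mult)

lemma norm_FT_le:
  assumes "integrable lborel a"
  shows "cmod (FT a t) \<le> (LINT f|lborel. cmod (a f))"
  unfolding FT_def by (rule order_trans[OF integral_norm_bound]) (simp add: norm_mult)

text \<open>The kernel is symmetric in \<open>t\<close> and \<open>f\<close>, so both sides are the
  same double integral by Fubini's theorem.\<close>

lemma FT_multiplication_formula:
  assumes a: "integrable lborel a" and b: "integrable lborel b"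
  shows "(LINT t|lborel. a t * FT b t) = (LINT f|lborel. FT a f * b f)"
proof -
  have [measurable]: "a \<in> borel_measurable borel" "b \<in> borel_measurable borel" using a b by auto
  have "integrable (lborel \<Otimes>\<^sub>M lborel) (\<lambda>(t, f). a t * b f * cis (2 * pi * f * t))"
  proof (rule lborel_pair.Fubini_integrable)
    show "integrable lborel (\<lambda>t. LINT f|lborel. norm (case (t, f) of (t, f) \<Rightarrow> a t * b f * cis (2 * pi * f * t)))"
      using a by (simp add: norm_mult)
    show "AE t in lborel. integrable lborel (\<lambda>f. case (t, f) of (t, f) \<Rightarrow> a t * b f * cis (2 * pi * f * t))"
    proof (intro AE_I2)
      fix t
      show "integrable lborel (\<lambda>f. case (t, f) of (t, f) \<Rightarrow> a t * b f * cis (2 * pi * f * t))"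
        using integrable_mult_right[OF integrable_cis_mult[OF b, of "2 * pi * t"], of "a t"]
        by (simp add: ac_simps)
    qed
  qed measurable
  from lborel_pair.Fubini_integral[OF this]
  have "(LINT f|lborel. LINT t|lborel. a t * b f * cis (2 * pi * f * t)) =
      (LINT t|lborel. LINT f|lborel. a t * b f * cis (2 * pi * f * t))" by simp
  moreover have "(LINT t|lborel. a t * b f * cis (2 * pi * f * t)) = FT a f * b f" for f
    unfolding FT_def by (simp add: ac_simps flip: integral_mult_right_zero integral_mult_left_zero)
  moreover have "(LINT f|lborel. a t * b f * cis (2 * pi * f * t)) = a t * FT b t" for t
    unfolding FT_def by (simp add: ac_simps flip: integral_mult_right_zero integral_mult_left_zero)
  ultimately show ?thesis by simp
qed

section \<open>Plancherel's inequality by Gaussian regularisation\<close>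

lemma integrable_norm_squared:
  fixes g :: "real \<Rightarrow> complex"
  assumes "integrable lborel g" and B: "\<And>f. cmod (g f) \<le> B"
  shows "integrable lborel (\<lambda>f. (cmod (g f))\<^sup>2)"
proof (rule Bochner_Integration.integrable_bound)
  show "integrable lborel (\<lambda>f. B * cmod (g f))" using assms by auto
  show "AE f in lborel. norm ((cmod (g f))\<^sup>2) \<le> norm (B * cmod (g f))"
    using B by (intro AE_I2) (auto simp: power2_eq_square abs_mult intro!: mult_right_mono order_trans[OF B])
qed (use assms in measurable)

text \<open>Scaled so that its transform is the normal density of standard deviation
  \<open>s\<close>: as \<open>s\<close> tends to 0 the weight tends to 1 at each time, while the
  transform concentrates at 0.\<close>

definition gauss :: "real \<Rightarrow> real \<Rightarrow> complex" where
  "gauss s t = complex_of_real (exp (- (2 * pi * s * t)\<^sup>2 / 2))"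

lemma gauss_measurable [measurable]: "gauss s \<in> borel_measurable borel"
  unfolding gauss_def[abs_def] by measurable

lemma gauss_eq_density:
  assumes "s > 0"
  shows "gauss s t = sqrt (2 * pi) * std_normal_density (2 * pi * s * t)"
  by (simp add: gauss_def std_normal_density_def)

lemma integrable_gauss:
  assumes "s > 0"
  shows "integrable lborel (gauss s)"
proof -
  have "integrable lborel (\<lambda>t. std_normal_density (0 + (2 * pi * s) * t))"
    using assms by (intro lborel_integrable_real_affine) auto
  then show ?thesis
    unfolding gauss_eq_density[OF assms, abs_def] by (simp del: of_real_mult)
qed

text \<open>The substitution \<open>z = 2 * pi * s * t\<close> turns the transform into the
  characteristic function of the standard normal distribution.\<close>

lemma FT_gauss:
  assumes "s > 0"
  shows "FT (gauss s) u = complex_of_real (std_normal_density (u / s) / s)"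
proof -
  have "complex_of_real (exp (- (u / s)\<^sup>2 / 2)) = char std_normal_distribution (u / s)"
    by (simp add: char_std_normal_distribution)
  also have "\<dots> = (LINT z|lborel. std_normal_density z *\<^sub>R cis (u / s * z))"
    unfolding char_def by (subst integral_density) (auto simp: cis_conv_exp)
  also have "\<dots> = \<bar>2 * pi * s\<bar> *\<^sub>R (LINT t|lborel. std_normal_density (0 + (2 * pi * s) * t) *\<^sub>R cis (u / s * (0 + (2 * pi * s) * t)))"
    using assms by (intro lborel_integral_real_affine) auto
  also have "\<dots> = \<bar>2 * pi * s\<bar> *\<^sub>R (LINT t|lborel. (1 / sqrt (2 * pi)) *\<^sub>R (gauss s t * cis (2 * pi * t * u)))"
  proof -
    have "std_normal_density (0 + (2 * pi * s) * t) *\<^sub>R cis (u / s * (0 + (2 * pi * s) * t)) =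
        (1 / sqrt (2 * pi)) *\<^sub>R (gauss s t * cis (2 * pi * t * u))" for t
    proof -
      have "u / s * (0 + (2 * pi * s) * t) = 2 * pi * t * u" using assms by simp
      then show ?thesis
        by (simp only: std_normal_density_def gauss_def) (simp add: scaleR_conv_of_real)
    qed
    then show ?thesis by (simp only:)
  qed
  also have "\<dots> = (\<bar>2 * pi * s\<bar> / sqrt (2 * pi)) *\<^sub>R FT (gauss s) u"
    unfolding FT_def by (subst integral_scaleR_right) simp
  finally have "FT (gauss s) u = (sqrt (2 * pi) / \<bar>2 * pi * s\<bar>) *\<^sub>R complex_of_real (exp (- (u / s)\<^sup>2 / 2))"
    using assms by simp
  also have "\<dots> = complex_of_real (sqrt (2 * pi) / (2 * pi * s) * exp (- (u / s)\<^sup>2 / 2))"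
    using assms by (simp add: scaleR_conv_of_real)
  also have "sqrt (2 * pi) / (2 * pi * s) * exp (- (u / s)\<^sup>2 / 2) = std_normal_density (u / s) / s"
    using assms by (simp add: std_normal_density_def field_simps flip: real_sqrt_mult)
  finally show ?thesis .
qed

lemma FT_modulated:
  "FT (\<lambda>t. a t * cis (2 * pi * h * t)) u = FT a (u + h)"
  unfolding FT_def
  by (intro Bochner_Integration.integral_cong) (auto simp: mult.assoc cis_mult algebra_simps)

text \<open>Makes the squared modulus of a transform a product of two transforms, as the
  multiplication formula requires.\<close>

lemma cnj_FT: "cnj (FT G t) = FT (\<lambda>f. cnj (G (- f))) t"
proof -
  have "cnj (FT G t) = (LINT f|lborel. cnj (G f * cis (2 * pi * f * t)))"
    unfolding FT_def by (rule Bochner_Integration.integral_cnj[symmetric])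
  also have "\<dots> = \<bar>-1\<bar> *\<^sub>R (LINT f|lborel. cnj (G (0 + (-1) * f) * cis (2 * pi * (0 + (-1) * f) * t)))"
    by (intro lborel_integral_real_affine) auto
  finally show ?thesis by (simp add: FT_def cis_cnj)
qed

text \<open>The multiplication formula moves the outer transform onto the modulated Gaussian, where
  it becomes a normal density centred at \<open>-h\<close>; the substitution
  \<open>f = s * y - h\<close> then shows an average of \<open>G\<close> near
  \<open>-h\<close>.\<close>

lemma FT_gauss_smoothing:
  assumes s: "s > 0" and G: "integrable lborel G"
  shows "FT (\<lambda>t. FT G t * gauss s t) h = (LINT y|lborel. G (s * y - h) * std_normal_density y)"
proof -
  have "FT (\<lambda>t. FT G t * gauss s t) h = (LINT t|lborel. (gauss s t * cis (2 * pi * h * t)) * FT G t)"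
    unfolding FT_def[of "\<lambda>t. FT G t * gauss s t"]
    by (intro Bochner_Integration.integral_cong) (auto simp: ac_simps)
  also have "\<dots> = (LINT f|lborel. FT (\<lambda>t. gauss s t * cis (2 * pi * h * t)) f * G f)"
    by (intro FT_multiplication_formula integrable_cis_mult integrable_gauss s G)
  also have "\<dots> = (LINT f|lborel. std_normal_density ((f + h) / s) / s * G f)"
    by (simp add: FT_modulated FT_gauss s)
  also have "\<dots> = \<bar>s\<bar> *\<^sub>R (LINT y|lborel. std_normal_density (((- h + s * y) + h) / s) / s * G (- h + s * y))"
    using s by (intro lborel_integral_real_affine) auto
  also have "\<dots> = (LINT y|lborel. G (s * y - h) * std_normal_density y)"
    using s by (subst integral_scaleR_right[symmetric])
      (auto intro!: Bochner_Integration.integral_cong simp: scaleR_conv_of_real)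
  finally show ?thesis .
qed

text \<open>Half of Plancherel's theorem suffices: by the multiplication formula, a Gaussian weight in time
  becomes a mollification of \<open>G\<close>, and the weight is at most 1.\<close>

lemma FT_norm_lower:
  assumes G: "integrable lborel G" and B: "\<And>f. cmod (G f) \<le> B" and cont: "\<And>f. isCont G f"
    and X: "integrable lborel (\<lambda>t. (cmod (FT G t))\<^sup>2)"
  shows "(LINT f|lborel. (cmod (G f))\<^sup>2) \<le> (LINT t|lborel. (cmod (FT G t))\<^sup>2)"
proof -
  have [measurable]: "G \<in> borel_measurable borel" using G by auto
  define s where "s n = inverse (real (Suc n))" for n
  have s: "s n > 0" for n by (simp add: s_def)
  have s0: "s \<longlonglongrightarrow> 0" unfolding s_def by (rule LIMSEQ_inverse_real_of_nat)
  define Gc where "Gc f = cnj (G (- f))" for f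
  have Gc: "integrable lborel Gc"
    using lborel_integrable_real_affine[OF G, of "-1" 0] unfolding Gc_def[abs_def] by simp
  define H where "H n h = (LINT y|lborel. G (s n * y - h) * std_normal_density y)" for n h
  have [measurable]: "H n \<in> borel_measurable borel" for n unfolding H_def[abs_def] by measurable
  have dens: "integrable lborel std_normal_density" "(LINT y|lborel. std_normal_density y) = 1"
    by auto
  have "B \<ge> 0" using B[of 0] norm_ge_zero order_trans by blast
  have Hb: "cmod (H n h) \<le> B" for n h
  proof -
    have "cmod (H n h) \<le> (LINT y|lborel. B * std_normal_density y)"
      unfolding H_def using B dens \<open>B \<ge> 0\<close>
      by (intro order_trans[OF integral_norm_bound] integral_mono')
         (auto simp: norm_mult intro!: mult_right_mono)
    then show ?thesis by simp
  qed
  \<comment> \<open>Continuity of \<open>G\<close> gives the pointwise limit of the integrands, and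
    the bound \<open>B\<close> gives the domination.\<close>
  have Hlim: "(\<lambda>n. H n h) \<longlonglongrightarrow> G (- h)" for h
  proof -
    have "(\<lambda>n. H n h) \<longlonglongrightarrow> (LINT y|lborel. G (- h) * std_normal_density y)"
      unfolding H_def
    proof (rule integral_dominated_convergence)
      show "integrable lborel (\<lambda>y. B * std_normal_density y)" using dens by auto
      show "AE y in lborel. (\<lambda>n. G (s n * y - h) * std_normal_density y) \<longlonglongrightarrow> G (- h) * std_normal_density y"
      proof (intro AE_I2 tendsto_mult tendsto_const)
        fix y
        have "(\<lambda>n. s n * y - h) \<longlonglongrightarrow> 0 * y - h" by (intro tendsto_intros s0)
        then show "(\<lambda>n. G (s n * y - h)) \<longlonglongrightarrow> G (- h)"
          by (intro isCont_tendsto_compose[OF cont]) simp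
      qed
      show "AE y in lborel. norm (G (s n * y - h) * std_normal_density y) \<le> B * std_normal_density y" for n
        using B by (auto simp: norm_mult intro!: mult_right_mono)
    qed auto
    also have "(LINT y|lborel. G (- h) * std_normal_density y) = G (- h)"
      using dens by (simp flip: integral_complex_of_real)
    finally show ?thesis .
  qed
  have eq: "complex_of_real (LINT t|lborel. (cmod (FT G t))\<^sup>2 * exp (- (2 * pi * s n * t)\<^sup>2 / 2))
      = (LINT h|lborel. H n h * Gc h)" for n
  proof -
    let ?C = "LINT f|lborel. cmod (G f)"
    \<comment> \<open>\<open>FT G\<close> is only known to be bounded and square integrable; the
      Gaussian factor makes it integrable, so that the multiplication formula applies.\<close>
    have int: "integrable lborel (\<lambda>t. FT G t * gauss (s n) t)"
    proof (rule Bochner_Integration.integrable_bound)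
      show "integrable lborel (\<lambda>t. ?C * gauss (s n) t)"
        by (intro integrable_mult_right integrable_gauss s)
      have "0 \<le> ?C" by simp
      then show "AE t in lborel. norm (FT G t * gauss (s n) t) \<le> norm (?C * gauss (s n) t)"
        by (intro AE_I2) (auto simp: norm_mult intro!: mult_right_mono norm_FT_le[OF G])
    qed simp
    have "complex_of_real (LINT t|lborel. (cmod (FT G t))\<^sup>2 * exp (- (2 * pi * s n * t)\<^sup>2 / 2))
        = (LINT t|lborel. complex_of_real ((cmod (FT G t))\<^sup>2 * exp (- (2 * pi * s n * t)\<^sup>2 / 2)))"
      by (rule integral_complex_of_real[symmetric])
    also have "\<dots> = (LINT t|lborel. (FT G t * gauss (s n) t) * FT Gc t)"
      unfolding Gc_def cnj_FT[symmetric]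
      by (intro Bochner_Integration.integral_cong refl)
         (simp add: gauss_def complex_norm_square del: of_real_power of_real_exp)
    also have "\<dots> = (LINT h|lborel. FT (\<lambda>t. FT G t * gauss (s n) t) h * Gc h)"
      by (rule FT_multiplication_formula[OF int Gc])
    finally show ?thesis by (simp add: FT_gauss_smoothing[OF s G] H_def)
  qed
  have "(\<lambda>n. LINT h|lborel. H n h * Gc h) \<longlonglongrightarrow> (LINT h|lborel. G (- h) * Gc h)"
  proof (rule integral_dominated_convergence)
    show "integrable lborel (\<lambda>h. B * cmod (Gc h))" using Gc by auto
    show "AE h in lborel. (\<lambda>n. H n h * Gc h) \<longlonglongrightarrow> G (- h) * Gc h"
      by (intro AE_I2 tendsto_intros Hlim)
    show "AE h in lborel. norm (H n h * Gc h) \<le> B * cmod (Gc h)" for n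
      using Hb by (auto simp: norm_mult intro!: mult_right_mono)
  qed (use Gc in auto)
  also have "(LINT h|lborel. G (- h) * Gc h) = (LINT h|lborel. complex_of_real ((cmod (G (0 + (-1) * h)))\<^sup>2))"
    by (intro Bochner_Integration.integral_cong refl) (simp add: Gc_def complex_norm_square del: of_real_power)
  also have "\<dots> = (LINT f|lborel. complex_of_real ((cmod (G f))\<^sup>2))"
    using lborel_integral_real_affine[of "-1" "\<lambda>f. complex_of_real ((cmod (G f))\<^sup>2)" 0]
    by (simp del: of_real_power integral_complex_of_real)
  also have "\<dots> = complex_of_real (LINT f|lborel. (cmod (G f))\<^sup>2)"
    by (rule integral_complex_of_real)
  finally have lim: "(\<lambda>n. LINT t|lborel. (cmod (FT G t))\<^sup>2 * exp (- (2 * pi * s n * t)\<^sup>2 / 2))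
      \<longlonglongrightarrow> (LINT f|lborel. (cmod (G f))\<^sup>2)"
    unfolding eq[symmetric] by (simp only: tendsto_of_real_iff)
  show ?thesis
  proof (rule LIMSEQ_le_const2[OF lim], intro exI allI impI)
    fix n
    show "(LINT t|lborel. (cmod (FT G t))\<^sup>2 * exp (- (2 * pi * s n * t)\<^sup>2 / 2)) \<le> (LINT t|lborel. (cmod (FT G t))\<^sup>2)"
      by (intro integral_mono' X) (auto intro!: mult_left_le)
  qed
qed

subsection \<open>The basic atom\<close>

text \<open>Vanishing at both ends of the cell already makes the transform decay quadratically, which is
  all that the tail estimate needs.\<close>

definition bump :: "real \<Rightarrow> real \<Rightarrow> complex" where
  "bump d f = complex_of_real (max 0 (f * (d - f)))"

lemma bump_measurable [measurable]: "bump d \<in> borel_measurable borel"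
  unfolding bump_def[abs_def] by measurable

lemma isCont_bump: "isCont (bump d) f"
  unfolding bump_def[abs_def] by (intro continuous_intros)

lemma norm_bump: "cmod (bump d f) = max 0 (f * (d - f))"
  unfolding bump_def by (simp only: norm_of_real)

lemma bump_outside: "d > 0 \<Longrightarrow> f \<notin> {0<..<d} \<Longrightarrow> bump d f = 0"
  by (auto simp: bump_def max_def not_less zero_le_mult_iff)

lemma norm_bump_le:
  assumes "d > 0"
  shows "cmod (bump d f) \<le> d\<^sup>2"
proof (cases "f \<in> {0<..<d}")
  case True
  then have "f * (d - f) \<le> d * d" by (intro mult_mono) auto
  then show ?thesis using True by (simp add: norm_bump power2_eq_square)
qed (use assms in \<open>simp add: bump_outside\<close>)

lemma norm_bump_ge:
  assumes "a \<ge> 0" "a \<le> f" "f \<le> d - a"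
  shows "cmod (bump d f) \<ge> a\<^sup>2"
proof -
  have "a * a \<le> f * (d - f)" using assms by (intro mult_mono) auto
  then show ?thesis by (simp add: norm_bump power2_eq_square)
qed

lemma integrable_indicator_Icc: "integrable lborel (indicator {a..b} :: real \<Rightarrow> real)"
  by (intro integrable_real_indicator) (auto simp: emeasure_lborel_Icc_eq)

lemma integrable_bump:
  assumes "d > 0"
  shows "integrable lborel (bump d)"
proof (rule Bochner_Integration.integrable_bound)
  show "integrable lborel (\<lambda>f. d\<^sup>2 * indicator {0..d} f :: real)"
    by (intro integrable_mult_right integrable_indicator_Icc)
  show "AE f in lborel. norm (bump d f) \<le> norm (d\<^sup>2 * indicator {0..d} f :: real)"
    using norm_bump_le[OF assms] bump_outside[OF assms]
    by (intro AE_I2) (auto simp: indicator_def)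
qed simp

lemma FT_bump_bounded:
  assumes "d > 0"
  shows "cmod (FT (bump d) t) \<le> d ^ 3"
proof -
  have "cmod (FT (bump d) t) \<le> (LINT f|lborel. cmod (bump d f))"
    by (intro norm_FT_le integrable_bump assms)
  also have "\<dots> \<le> (LINT f|lborel. d\<^sup>2 * indicator {0..d} f)"
  proof (rule integral_mono')
    show "integrable lborel (\<lambda>f. d\<^sup>2 * indicator {0..d} f :: real)"
      by (intro integrable_mult_right integrable_indicator_Icc)
    show "cmod (bump d f) \<le> d\<^sup>2 * indicator {0..d} f" for f
      using norm_bump_le[OF assms, of f] bump_outside[OF assms, of f] by (auto simp: indicator_def)
  qed simp
  also have "\<dots> = d ^ 3" using assms by (simp add: power3_eq_cube power2_eq_square)
  finally show ?thesis .
qed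

lemma cis_has_vector_derivative:
  "((\<lambda>f. cis (c * f)) has_vector_derivative \<i> * complex_of_real c * cis (c * f)) (at f within S)"
  by (auto simp: cis_conv_exp intro!: derivative_eq_intros has_vector_derivative_real_field)

text \<open>An explicit antiderivative carries out the integrations by parts. Its term of order
  \<open>1 / z\<close> vanishes at both ends of the cell, which leaves the orders 2 and 3 in
  \<open>1 / z\<close>.\<close>

lemma FT_bump_decay:
  assumes d: "d > 0" and t: "\<bar>t\<bar> \<ge> 1"
  shows "cmod (FT (bump d) t) \<le> (2 * d + 4) / t\<^sup>2"
proof -
  define z where "z = \<i> * complex_of_real (2 * pi * t)"
  have z: "z \<noteq> 0" using t by (auto simp: z_def)
  \<comment> \<open>With \<open>p f = f * (d - f)\<close> this is
    \<open>p / z - p' / z^2 + p'' / z^3\<close>, the factor of the exponential in an antiderivative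
    of \<open>p f * exp (z * f)\<close>.\<close>
  define P where "P f = complex_of_real (f * (d - f)) / z - complex_of_real (d - 2 * f) / z\<^sup>2 - 2 / z ^ 3" for f
  define Q where "Q f = P f * cis (2 * pi * t * f)" for f
  have Q: "(Q has_vector_derivative complex_of_real (f * (d - f)) * cis (2 * pi * t * f)) (at f within {0..d})"
    for f
  proof -
    have P: "(P has_vector_derivative complex_of_real (d - 2 * f) / z + 2 / z\<^sup>2) (at f within {0..d})"
      unfolding P_def[abs_def] using z
      by (auto intro!: derivative_eq_intros simp: field_simps)
    have "(Q has_vector_derivative P f * (z * cis (2 * pi * t * f)) +
        (complex_of_real (d - 2 * f) / z + 2 / z\<^sup>2) * cis (2 * pi * t * f)) (at f within {0..d})"
      unfolding Q_def[abs_def]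
      using has_vector_derivative_mult[OF P cis_has_vector_derivative[of "2 * pi * t"]] by (simp add: z_def)
    also have "P f * (z * cis (2 * pi * t * f)) + (complex_of_real (d - 2 * f) / z + 2 / z\<^sup>2) * cis (2 * pi * t * f)
       = complex_of_real (f * (d - f)) * cis (2 * pi * t * f)"
      using z by (simp add: P_def field_simps power2_eq_square power3_eq_cube)
    finally show ?thesis .
  qed
  have "FT (bump d) t = (LINT f|lborel. indicator {0..d} f *\<^sub>R (complex_of_real (f * (d - f)) * cis (2 * pi * t * f)))"
    unfolding FT_def
  proof (intro Bochner_Integration.integral_cong refl)
    fix f
    show "bump d f * cis (2 * pi * f * t) = indicator {0..d} f *\<^sub>R (complex_of_real (f * (d - f)) * cis (2 * pi * t * f))"
      using bump_outside[OF d, of f] by (auto simp: bump_def indicator_def ac_simps max_def)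
  qed
  also have "\<dots> = Q d - Q 0"
    using d by (intro integral_FTC_atLeastAtMost Q) (auto intro!: continuous_intros)
  also have "cmod (Q d - Q 0) \<le> cmod (P d) + cmod (P 0)"
    by (rule order_trans[OF norm_triangle_ineq4]) (simp add: Q_def norm_mult)
  also have "\<dots> \<le> 2 * (d / (cmod z)\<^sup>2 + 2 / (cmod z) ^ 3)"
  proof -
    have "P d = complex_of_real d / z\<^sup>2 - 2 / z ^ 3" "P 0 = - (complex_of_real d / z\<^sup>2) - 2 / z ^ 3"
      by (simp_all add: P_def)
    then have "cmod (P d) \<le> cmod (complex_of_real d / z\<^sup>2) + cmod (2 / z ^ 3)"
      "cmod (P 0) \<le> cmod (complex_of_real d / z\<^sup>2) + cmod (2 / z ^ 3)"
      by (metis norm_triangle_ineq4, metis norm_triangle_ineq4 norm_minus_cancel)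
    then show ?thesis using d by (simp add: norm_divide norm_power)
  qed
  also have "\<dots> \<le> 2 * (d / t\<^sup>2 + 2 / t\<^sup>2)"
  proof -
    have "1 * \<bar>t\<bar> \<le> (2 * pi) * \<bar>t\<bar>" using pi_gt3 by (intro mult_right_mono) auto
    then have zt: "cmod z \<ge> \<bar>t\<bar>" by (simp add: z_def norm_mult abs_mult)
    have 2: "t\<^sup>2 \<le> (cmod z)\<^sup>2" using power_mono[OF zt, of 2] by simp
    have "(cmod z)\<^sup>2 * 1 \<le> (cmod z)\<^sup>2 * cmod z" using zt t by (intro mult_left_mono) auto
    then have 3: "t\<^sup>2 \<le> (cmod z) ^ 3" using 2 by (simp add: power3_eq_cube power2_eq_square)
    have "t\<^sup>2 > 0" using t by auto
    then show ?thesis using 2 3 d by (intro mult_left_mono add_mono divide_left_mono mult_pos_pos) auto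
  qed
  finally show ?thesis using t by (simp add: field_simps)
qed

text \<open>Merges the decay for large times with the trivial bound for small ones. The factor 2 in
  the constant pays for \<open>1 + t^2 <= 2 * t^2\<close> in the first case and for
  \<open>1 + t^2 <= 2\<close> in the second.\<close>

lemma FT_bump_quadratic_decay:
  assumes d: "d > 0"
  shows "\<exists>C>0. \<forall>t. cmod (FT (bump d) t) \<le> C / (1 + t\<^sup>2)"
proof (intro exI conjI allI)
  let ?C = "2 * (d ^ 3 + 2 * d + 4)"
  show "?C > 0" using d by (intro mult_pos_pos add_pos_pos) auto
  fix t :: real
  have pos: "1 + t\<^sup>2 > 0" using zero_le_power2[of t] by linarith
  show "cmod (FT (bump d) t) \<le> ?C / (1 + t\<^sup>2)"
  proof (cases "\<bar>t\<bar> \<ge> 1")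
    case True
    then have t: "t\<^sup>2 \<ge> 1" by (metis abs_le_square_iff abs_one one_power2)
    have "cmod (FT (bump d) t) \<le> (2 * d + 4) / t\<^sup>2" by (rule FT_bump_decay[OF d True])
    also have "\<dots> \<le> (2 * (2 * d + 4)) / (1 + t\<^sup>2)"
    proof -
      have "(2 * d + 4) * (1 + t\<^sup>2) \<le> (2 * d + 4) * (2 * t\<^sup>2)"
        using t d by (intro mult_left_mono) auto
      then have "(2 * d + 4) * (1 + t\<^sup>2) \<le> 2 * (2 * d + 4) * t\<^sup>2" by (simp only: mult_ac)
      moreover have "t\<^sup>2 > 0" using t by linarith
      ultimately show ?thesis using pos by (simp only: pos_divide_le_eq pos_le_divide_eq times_divide_eq_left)
    qed
    also have "\<dots> \<le> ?C / (1 + t\<^sup>2)" using d pos by (intro divide_right_mono) auto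
    finally show ?thesis .
  next
    case False
    then have t: "t\<^sup>2 \<le> 1" by (simp add: abs_square_le_1)
    have "cmod (FT (bump d) t) \<le> d ^ 3" by (rule FT_bump_bounded[OF d])
    also have "\<dots> \<le> (2 * d ^ 3) / (1 + t\<^sup>2)"
    proof -
      have "d ^ 3 * (1 + t\<^sup>2) \<le> d ^ 3 * 2"
        using t d by (intro mult_left_mono) auto
      then show ?thesis using pos by (simp add: divide_simps mult_ac)
    qed
    also have "\<dots> \<le> ?C / (1 + t\<^sup>2)" using d pos by (intro divide_right_mono) auto
    finally show ?thesis .
  qed
qed

text \<open>For such \<open>t\<close> the phase stays within \<open>pi / 3\<close> on the support of
  the bump, so the real part is at least half the bump, and the bump is at least
  \<open>d^2 / 16\<close> on the middle half. This later bounds from below what a sample near the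
  centre of an atom contributes.\<close>

lemma FT_bump_ge:
  assumes d: "d > 0" and t: "\<bar>t\<bar> \<le> 1 / (6 * d)"
  shows "cmod (FT (bump d) t) \<ge> d ^ 3 / 64"
proof -
  have int: "integrable lborel (\<lambda>f. bump d f * cis (2 * pi * f * t))"
    using integrable_cis_mult[OF integrable_bump[OF d], of "2 * pi * t"] by (simp add: ac_simps)
  have "d ^ 3 / 64 = (LINT f|lborel. d\<^sup>2 / 32 * indicator {d/4..3*d/4} f)"
    using d by (simp add: power3_eq_cube power2_eq_square)
  also have "\<dots> \<le> (LINT f|lborel. Re (bump d f * cis (2 * pi * f * t)))"
  proof (rule integral_mono)
    show "integrable lborel (\<lambda>f. Re (bump d f * cis (2 * pi * f * t)))" by (rule integrable_Re[OF int])
    fix f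
    show "d\<^sup>2 / 32 * indicator {d/4..3*d/4} f \<le> Re (bump d f * cis (2 * pi * f * t))"
    proof (cases "f \<in> {0<..<d}")
      case True
      have "\<bar>f\<bar> * \<bar>t\<bar> \<le> d * (1 / (6 * d))" using True t by (intro mult_mono) auto
      then have "\<bar>2 * pi * f * t\<bar> \<le> pi / 3" using d by (simp add: abs_mult field_simps)
      then have "cos (pi / 3) \<le> cos \<bar>2 * pi * f * t\<bar>" by (intro cos_monotone_0_pi_le) auto
      then have c: "cos (2 * pi * f * t) \<ge> 1 / 2" by (simp add: cos_60)
      have b: "d\<^sup>2 / 16 * indicator {d/4..3*d/4} f \<le> cmod (bump d f)"
        using norm_bump_ge[of "d/4" f d] d by (auto simp: indicator_def power2_eq_square)
      have "d\<^sup>2 / 32 * indicator {d/4..3*d/4} f = (d\<^sup>2 / 16 * indicator {d/4..3*d/4} f) * (1/2)" by simp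
      also have "\<dots> \<le> cmod (bump d f) * cos (2 * pi * f * t)"
        by (rule mult_mono[OF b c]) auto
      also have "\<dots> = Re (complex_of_real (cmod (bump d f)) * cis (2 * pi * f * t))" by simp
      also have "complex_of_real (cmod (bump d f)) = bump d f" by (simp only: norm_bump) (simp only: bump_def)
      finally show ?thesis .
    qed (use d in \<open>auto simp: bump_outside[OF d] indicator_def\<close>)
  qed (intro integrable_mult_right integrable_indicator_Icc)
  also have "\<dots> = Re (FT (bump d) t)"
    unfolding FT_def using int by (rule integral_Re)
  also have "\<dots> \<le> cmod (FT (bump d) t)" by (rule complex_Re_le_cmod)
  finally show ?thesis .
qed

lemma FT_shift: "FT (\<lambda>f. a (f - x)) t = cis (2 * pi * x * t) * FT a t"
proof -
  have "FT (\<lambda>f. a (f - x)) t = \<bar>1\<bar> *\<^sub>R (LINT f|lborel. a ((x + 1 * f) - x) * cis (2 * pi * (x + 1 * f) * t))"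
    unfolding FT_def by (rule lborel_integral_real_affine) simp
  also have "\<dots> = (LINT f|lborel. cis (2 * pi * x * t) * (a f * cis (2 * pi * f * t)))"
    by (auto intro!: Bochner_Integration.integral_cong simp: cis_mult algebra_simps)
  also have "\<dots> = cis (2 * pi * x * t) * FT a t" unfolding FT_def by (rule integral_mult_right_zero)
  finally show ?thesis .
qed

section \<open>Quadratic sums over point sets with bounded local counts\<close>

lemma integrable_inverse_one_plus_square: "integrable lborel (\<lambda>x::real. 1 / (1 + x\<^sup>2))"
  using integrable_inverse_1_plus_square
  by (simp add: set_integrable_def einterval_def inverse_eq_divide)

text \<open>Each term is compared with the integral of the weight over \<open>{t..t + r}\<close>; no point lies in more
  than \<open>c\<close> of these intervals.\<close>

lemma separated_quadratic_sum:
  fixes S :: "real set"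
  assumes r: "r > 0" and fin: "\<And>x. finite {t\<in>S. \<bar>t - x\<bar> \<le> r}"
    and card: "\<And>x. real (card {t\<in>S. \<bar>t - x\<bar> \<le> r}) \<le> c"
  shows "\<exists>C\<ge>0. \<forall>x E. finite E \<longrightarrow> E \<subseteq> S \<longrightarrow> (\<Sum>t\<in>E. 1 / (1 + (t - x)\<^sup>2)) \<le> C"
proof -
  define I where "I = (LINT x|lborel. 1 / (1 + x\<^sup>2 :: real))"
  have I: "I \<ge> 0" unfolding I_def by simp
  have c: "c \<ge> 0" using card[of 0] by linarith
  have trans_int: "integrable lborel (\<lambda>y. 1 / (1 + (y - x)\<^sup>2))" for x :: real
    using lborel_integrable_real_affine[OF integrable_inverse_one_plus_square, of 1 "-x"] by simp
  have trans: "(LINT y|lborel. 1 / (1 + (y - x)\<^sup>2)) = I" for x :: real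
    unfolding I_def
    using lborel_integral_real_affine[of 1 "\<lambda>x. 1 / (1 + x\<^sup>2 :: real)" "- x"] by simp
  let ?K = "(2 + 2 * r\<^sup>2) / r"
  have main: "(\<Sum>t\<in>E. 1 / (1 + (t - x)\<^sup>2)) \<le> ?K * (c * I)" if E: "finite E" "E \<subseteq> S" for x E
  proof -
    have int: "integrable lborel (\<lambda>y. indicator {t..t + r} y * (1 / (1 + (y - x)\<^sup>2)))" for t
      by (rule Bochner_Integration.integrable_bound[OF trans_int[of x]]) (auto simp: indicator_def)
    have one: "1 / (1 + (t - x)\<^sup>2) \<le> ?K * (LINT y|lborel. indicator {t..t + r} y * (1 / (1 + (y - x)\<^sup>2)))" for t
    proof -
      have "r * (1 / ((2 + 2 * r\<^sup>2) * (1 + (t - x)\<^sup>2))) = (LINT y|lborel. indicator {t..t + r} y * (1 / ((2 + 2 * r\<^sup>2) * (1 + (t - x)\<^sup>2))))"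
        using r by simp
      also have "\<dots> \<le> (LINT y|lborel. indicator {t..t + r} y * (1 / (1 + (y - x)\<^sup>2)))"
      proof (rule integral_mono[OF _ int])
        fix y
        \<comment> \<open>Replacing \<open>t\<close> by a point at distance at most \<open>r\<close>
          changes the weight by a factor of at most \<open>2 + 2 * r^2\<close>, because the square
          of a sum is at most twice the sum of the squares.\<close>
        have "1 + (y - x)\<^sup>2 \<le> (2 + 2 * r\<^sup>2) * (1 + (t - x)\<^sup>2)" if "y \<in> {t..t + r}"
        proof -
          have "(y - t)\<^sup>2 \<le> r\<^sup>2" using that by (intro power_mono) auto
          moreover have "(y - x)\<^sup>2 \<le> 2 * (y - t)\<^sup>2 + 2 * (t - x)\<^sup>2"
            using sum_squares_ge_zero[of "(y - t) - (t - x)" 0] by (simp add: power2_eq_square algebra_simps)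
          moreover have "0 \<le> r\<^sup>2 * (t - x)\<^sup>2" by simp
          moreover have "(2 + 2 * r\<^sup>2) * (1 + (t - x)\<^sup>2) =
              2 + 2 * r\<^sup>2 + 2 * (t - x)\<^sup>2 + 2 * (r\<^sup>2 * (t - x)\<^sup>2)"
            by (simp add: ring_distribs)
          ultimately show ?thesis by linarith
        qed
        then show "indicator {t..t + r} y * (1 / ((2 + 2 * r\<^sup>2) * (1 + (t - x)\<^sup>2))) \<le> indicator {t..t + r} y * (1 / (1 + (y - x)\<^sup>2))"
          by (auto simp: indicator_def intro!: divide_left_mono mult_pos_pos add_pos_nonneg)
      qed (intro integrable_mult_left integrable_indicator_Icc)
      finally have "?K * (r * (1 / ((2 + 2 * r\<^sup>2) * (1 + (t - x)\<^sup>2)))) \<le> ?K * (LINT y|lborel. indicator {t..t + r} y * (1 / (1 + (y - x)\<^sup>2)))"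
        using r by (intro mult_left_mono) auto
      moreover have "?K * (r * (1 / ((2 + 2 * r\<^sup>2) * (1 + (t - x)\<^sup>2)))) = 1 / (1 + (t - x)\<^sup>2)"
      proof -
        have "2 + 2 * r\<^sup>2 \<noteq> 0" using zero_le_power2[of r] by linarith
        then show ?thesis using r by (simp add: divide_simps)
      qed
      ultimately show ?thesis by simp
    qed
    have "(\<Sum>t\<in>E. 1 / (1 + (t - x)\<^sup>2)) \<le> (\<Sum>t\<in>E. ?K * (LINT y|lborel. indicator {t..t + r} y * (1 / (1 + (y - x)\<^sup>2))))"
      by (intro sum_mono one)
    also have "\<dots> = ?K * (LINT y|lborel. (\<Sum>t\<in>E. indicator {t..t + r} y * (1 / (1 + (y - x)\<^sup>2))))"
      using int by (simp only: sum_distrib_left[symmetric] Bochner_Integration.integral_sum)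
    finally have le: "(\<Sum>t\<in>E. 1 / (1 + (t - x)\<^sup>2)) \<le>
      ?K * (LINT y|lborel. (\<Sum>t\<in>E. indicator {t..t + r} y * (1 / (1 + (y - x)\<^sup>2))))" .
    have "(LINT y|lborel. (\<Sum>t\<in>E. indicator {t..t + r} y * (1 / (1 + (y - x)\<^sup>2)))) \<le> (LINT y|lborel. c * (1 / (1 + (y - x)\<^sup>2)))"
    proof (rule integral_mono)
      fix y
      \<comment> \<open>The intervals that contain \<open>y\<close> start within \<open>r\<close> of
        \<open>y\<close>, so the local count bounds their number.\<close>
      have "(\<Sum>t\<in>E. indicator {t..t + r} y :: real) = real (card {t\<in>E. y \<in> {t..t + r}})"
        using E(1) by (simp add: indicator_def sum.If_cases Int_def)
      also have "\<dots> \<le> real (card {t\<in>S. \<bar>t - y\<bar> \<le> r})"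
        using E fin by (intro of_nat_mono card_mono) auto
      also have "\<dots> \<le> c" by (rule card)
      finally show "(\<Sum>t\<in>E. indicator {t..t + r} y * (1 / (1 + (y - x)\<^sup>2))) \<le> c * (1 / (1 + (y - x)\<^sup>2))"
        unfolding sum_distrib_right[symmetric] by (intro mult_right_mono) auto
    qed (use int trans_int in \<open>auto intro!: Bochner_Integration.integrable_sum integrable_mult_right simp del: times_divide_eq_right\<close>)
    also have "\<dots> = c * I" using trans[of x] by (simp only: integral_mult_right_zero)
    finally have "(LINT y|lborel. (\<Sum>t\<in>E. indicator {t..t + r} y * (1 / (1 + (y - x)\<^sup>2)))) \<le> c * I" .
    then have "?K * (LINT y|lborel. (\<Sum>t\<in>E. indicator {t..t + r} y * (1 / (1 + (y - x)\<^sup>2)))) \<le> ?K * (c * I)"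
      using r by (intro mult_left_mono) auto
    with le show ?thesis by (rule order_trans)
  qed
  show ?thesis
  proof (intro exI[of _ "?K * (c * I)"] conjI allI impI)
    show "0 \<le> ?K * (c * I)" using r I c by simp
  qed (rule main)
qed

subsection \<open>Signals on a frequency grid\<close>

lemma cis_eq_1_int: "cis (2 * pi * real_of_int m) = 1"
  by (metis Ints_of_int cis_multiple_2pi)

text \<open>For nonzero \<open>m\<close> the antiderivative has period \<open>l\<close>, so its
  values at the two ends cancel.\<close>

lemma integral_cis_period:
  fixes m :: int
  assumes l: "l > 0"
  shows "(LINT f|lborel. indicator {a..a+l} f *\<^sub>R cis (2 * pi * real_of_int m / l * f)) = (if m = 0 then complex_of_real l else 0)"
proof (cases "m = 0")
  case True
  then have "(LINT f|lborel. indicator {a..a+l} f *\<^sub>R cis (2 * pi * real_of_int m / l * f))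
     = (LINT f|lborel. complex_of_real (indicator {a..a+l} f))"
    by (intro Bochner_Integration.integral_cong) (auto simp: scaleR_conv_of_real)
  also have "\<dots> = complex_of_real (LINT f|lborel. indicator {a..a+l} f)" by (rule integral_complex_of_real)
  finally show ?thesis using True l by simp
next
  case False
  define w where "w = 2 * pi * real_of_int m / l"
  have w: "w \<noteq> 0" using False l by (simp add: w_def)
  define P where "P f = cis (w * f) / (\<i> * complex_of_real w)" for f
  have "(P has_vector_derivative cis (w * f)) (at f within {a..a+l})" for f
    unfolding P_def[abs_def]
    using has_vector_derivative_mult_right[OF cis_has_vector_derivative[of w f "{a..a+l}"], of "1 / (\<i> * complex_of_real w)"] w
    by simp
  then have "(LINT f|lborel. indicator {a..a+l} f *\<^sub>R cis (w * f)) = P (a + l) - P a"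
    using l by (intro integral_FTC_atLeastAtMost) (auto intro!: continuous_intros)
  moreover have "w * (a + l) = w * a + 2 * pi * real_of_int m"
    using l by (simp add: w_def distrib_left)
  then have "cis (w * (a + l)) = cis (w * a) * cis (2 * pi * real_of_int m)"
    by (simp only: cis_mult)
  then have "P (a + l) - P a = 0" by (simp add: P_def cis_eq_1_int)
  ultimately show ?thesis using False l by (simp add: w_def)
qed

text \<open>The square expands into a double sum, and integration over a full period leaves only the
  diagonal. The left end \<open>a\<close> is arbitrary, so the identity can be used inside any
  cell.\<close>

lemma exponentials_parseval:
  fixes K :: "int set" and b :: "int \<Rightarrow> complex"
  assumes l: "l > 0" and K: "finite K"
  shows "(LINT f|lborel. indicator {a..a+l} f * (cmod (\<Sum>k\<in>K. b k * cis (- (2 * pi * real_of_int k / l * f))))\<^sup>2)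
           = l * (\<Sum>k\<in>K. (cmod (b k))\<^sup>2)"
proof -
  let ?e = "\<lambda>m f. indicator {a..a+l} f *\<^sub>R cis (2 * pi * real_of_int m / l * f)"
  have int: "integrable lborel (?e m)" for m
    using l by (intro borel_integrable_compact) (auto intro!: continuous_intros)
  have "complex_of_real (LINT f|lborel. indicator {a..a+l} f * (cmod (\<Sum>k\<in>K. b k * cis (- (2 * pi * real_of_int k / l * f))))\<^sup>2)
    = (LINT f|lborel. complex_of_real (indicator {a..a+l} f * (cmod (\<Sum>k\<in>K. b k * cis (- (2 * pi * real_of_int k / l * f))))\<^sup>2))"
    by (rule integral_complex_of_real[symmetric])
  also have "\<dots> = (LINT f|lborel. (\<Sum>k\<in>K. \<Sum>j\<in>K. b k * cnj (b j) * ?e (j - k) f))"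
  proof (intro Bochner_Integration.integral_cong refl)
    fix f
    have "complex_of_real ((cmod (\<Sum>k\<in>K. b k * cis (- (2 * pi * real_of_int k / l * f))))\<^sup>2)
      = (\<Sum>k\<in>K. b k * cis (- (2 * pi * real_of_int k / l * f))) * (\<Sum>j\<in>K. cnj (b j) * cis (2 * pi * real_of_int j / l * f))"
      by (simp add: complex_norm_square cis_cnj del: of_real_power)
    also have "\<dots> = (\<Sum>k\<in>K. \<Sum>j\<in>K. b k * cnj (b j) * cis (2 * pi * real_of_int (j - k) / l * f))"
    proof -
      have "(b k * cis (- (2 * pi * real_of_int k / l * f))) * (cnj (b j) * cis (2 * pi * real_of_int j / l * f))
          = b k * cnj (b j) * cis (2 * pi * real_of_int (j - k) / l * f)" for k j
      proof -
        have "cis (- (2 * pi * real_of_int k / l * f)) * cis (2 * pi * real_of_int j / l * f) = cis (2 * pi * real_of_int (j - k) / l * f)"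
          by (simp add: cis_mult algebra_simps diff_divide_distrib)
        then show ?thesis by (metis (no_types, lifting) mult.assoc mult.left_commute)
      qed
      then show ?thesis unfolding sum_product by (intro sum.cong refl)
    qed
    finally show "complex_of_real (indicator {a..a+l} f * (cmod (\<Sum>k\<in>K. b k * cis (- (2 * pi * real_of_int k / l * f))))\<^sup>2)
       = (\<Sum>k\<in>K. \<Sum>j\<in>K. b k * cnj (b j) * ?e (j - k) f)"
      by (cases "f \<in> {a..a+l}") (simp_all del: of_real_power)
  qed
  also have "\<dots> = (\<Sum>k\<in>K. \<Sum>j\<in>K. b k * cnj (b j) * (LINT f|lborel. ?e (j - k) f))"
    by (simp only: Bochner_Integration.integral_sum Bochner_Integration.integrable_sum
        integrable_mult_right int integral_mult_right_zero)
  also have "\<dots> = (\<Sum>k\<in>K. \<Sum>j\<in>K. if k = j then b k * cnj (b k) * complex_of_real l else 0)"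
    by (intro sum.cong refl) (simp only: integral_cis_period[OF l], auto)
  also have "\<dots> = complex_of_real (l * (\<Sum>k\<in>K. (cmod (b k))\<^sup>2))"
    using K by (simp add: complex_norm_square sum_distrib_left mult_ac del: of_real_power)
  finally show ?thesis by (simp only: of_real_eq_iff)
qed

lemma FT_sum:
  assumes "\<And>i. i \<in> A \<Longrightarrow> integrable lborel (g i)"
  shows "FT (\<lambda>f. \<Sum>i\<in>A. g i f) t = (\<Sum>i\<in>A. FT (g i) t)"
proof -
  have "integrable lborel (\<lambda>f. g i f * cis (2 * pi * f * t))" if "i \<in> A" for i
    using integrable_cis_mult[OF assms[OF that], of "2 * pi * t"] by (simp add: ac_simps)
  then show ?thesis
    unfolding FT_def by (simp add: sum_distrib_right Bochner_Integration.integral_sum)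
qed

lemma FT_cmult: "FT (\<lambda>f. z * a f) t = z * FT a t"
  unfolding FT_def mult.assoc by (rule integral_mult_right_zero)

lemma norm_sum_mult_squared_le:
  fixes a b :: "'i \<Rightarrow> complex"
  shows "(cmod (\<Sum>i\<in>A. a i * b i))\<^sup>2 \<le> (\<Sum>i\<in>A. (cmod (a i))\<^sup>2) * (\<Sum>i\<in>A. (cmod (b i))\<^sup>2)"
proof -
  have "cmod (\<Sum>i\<in>A. a i * b i) \<le> (\<Sum>i\<in>A. cmod (a i) * cmod (b i))"
    by (rule order_trans[OF norm_sum]) (simp add: norm_mult)
  then have "(cmod (\<Sum>i\<in>A. a i * b i))\<^sup>2 \<le> (\<Sum>i\<in>A. cmod (a i) * cmod (b i))\<^sup>2"
    by (intro power_mono) auto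
  also have "\<dots> \<le> (\<Sum>i\<in>A. (cmod (a i))\<^sup>2) * (\<Sum>i\<in>A. (cmod (b i))\<^sup>2)"
    by (rule Cauchy_Schwarz_ineq_sum)
  finally show ?thesis .
qed

section \<open>Frequency cells and the signals built on them\<close>

definition cell :: "real \<Rightarrow> int \<Rightarrow> real set" where
  "cell d q = {real_of_int q * d ..< (real_of_int q + 1) * d}"

text \<open>Half-open cells tile the line: the only cell containing \<open>x\<close> has the floor
  of \<open>x / d\<close> as its index.\<close>

lemma cell_disjoint:
  assumes "d > 0" "x \<in> cell d q" "x \<in> cell d q'"
  shows "q = q'"
proof -
  have "q = \<lfloor>x / d\<rfloor>" if "x \<in> cell d q" for q
    using that assms(1) by (auto simp: cell_def field_simps intro!: floor_unique[symmetric])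
  then show ?thesis using assms by metis
qed

text \<open>\<open>d\<close> is the length of a cell and \<open>l\<close> the period of the
  exponentials, so that time shifts are multiples of \<open>1 / l\<close>. As \<open>l < d\<close>,
  an interval of length \<open>l\<close> fits strictly inside a cell, where the bump is bounded away
  from 0.\<close>

locale cell_grid =
  fixes N :: nat and U :: "nat \<Rightarrow> nat \<Rightarrow> complex" and F :: "nat \<Rightarrow> real set"
    and d l :: real and Q :: "int set"
  assumes l_pos: "0 < l" and l_less: "l < d" and finite_Q: "finite Q"
    and F_borel: "\<And>i. i < N \<Longrightarrow> F i \<in> sets borel"
begin

lemma d_pos: "d > 0" using l_pos l_less by simp

text \<open>On a cell free of jump points this is the set of active indices of each of its
  frequencies.\<close>

definition act :: "int \<Rightarrow> nat set" where
  "act q = {i. i < N \<and> cell d q \<subseteq> F i}"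

text \<open>Labels of the unknown coefficients: cell, eigen-index, and time shift in units of
  \<open>1 / l\<close>.\<close>

definition idx :: "int set \<Rightarrow> (int \<times> nat \<times> int) set" where
  "idx K = (SIGMA q:Q. act q \<times> K)"

text \<open>A bump moved to its cell; the exponential centres its transform at the time
  \<open>k / l\<close>.\<close>

definition tile :: "int \<Rightarrow> int \<Rightarrow> real \<Rightarrow> complex" where
  "tile q k f = bump d (f - real_of_int q * d) * cis (2 * pi * (- (real_of_int k / l)) * f)"

text \<open>Closed form of the transform of \<open>tile q k\<close>.\<close>

definition atom :: "int \<Rightarrow> int \<Rightarrow> real \<Rightarrow> complex" where
  "atom q k t = cis (2 * pi * (real_of_int q * d) * (t - real_of_int k / l)) * FT (bump d) (t - real_of_int k / l)"

text \<open>The joint spectrum at eigen-index \<open>i\<close>. The guard suppresses cells not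
  contained in \<open>F i\<close>, whatever values \<open>c\<close> has there.\<close>

definition spec :: "int set \<Rightarrow> (int \<times> nat \<times> int \<Rightarrow> complex) \<Rightarrow> nat \<Rightarrow> real \<Rightarrow> complex" where
  "spec K c i f = (\<Sum>q\<in>Q. \<Sum>k\<in>K. (if i \<in> act q then c (q, i, k) else 0) * tile q k f)"

text \<open>The spectrum seen at vertex \<open>v\<close>, whose transform is
  \<open>sig K c v\<close>.\<close>

definition vspec :: "int set \<Rightarrow> (int \<times> nat \<times> int \<Rightarrow> complex) \<Rightarrow> nat \<Rightarrow> real \<Rightarrow> complex" where
  "vspec K c v f = (\<Sum>i<N. cnj (U v i) * spec K c i f)"

definition sig :: "int set \<Rightarrow> (int \<times> nat \<times> int \<Rightarrow> complex) \<Rightarrow> nat \<Rightarrow> real \<Rightarrow> complex" where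
  "sig K c v t = (\<Sum>(q, i, k)\<in>idx K. c (q, i, k) * (cnj (U v i) * atom q k t))"

lemma finite_act [simp]: "finite (act q)" by (simp add: act_def)

lemma finite_idx [simp]: "finite K \<Longrightarrow> finite (idx K)" by (simp add: idx_def finite_Q)

lemma tile_measurable [measurable]: "tile q k \<in> borel_measurable borel"
  unfolding tile_def[abs_def] by measurable

lemma tile_outside: "f \<notin> cell d q \<Longrightarrow> tile q k f = 0"
  using bump_outside[OF d_pos, of "f - real_of_int q * d"] by (auto simp: tile_def cell_def algebra_simps)

lemma isCont_tile: "isCont (tile q k) f"
proof -
  have "isCont (\<lambda>f. bump d (f - real_of_int q * d)) f"
    by (rule isCont_o2[OF _ isCont_bump]) simp
  moreover have "continuous_on UNIV (\<lambda>f. cis (2 * pi * (- (real_of_int k / l)) * f))"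
    by (intro continuous_intros)
  then have "isCont (\<lambda>f. cis (2 * pi * (- (real_of_int k / l)) * f)) f"
    by (simp add: continuous_on_eq_continuous_at)
  ultimately show ?thesis unfolding tile_def[abs_def] by (intro continuous_intros)
qed

lemma integrable_tile: "integrable lborel (tile q k)"
  unfolding tile_def[abs_def]
  using lborel_integrable_real_affine[OF integrable_bump[OF d_pos], of 1 "- (real_of_int q * d)"]
  by (intro integrable_cis_mult) simp

lemma norm_tile: "cmod (tile q k f) \<le> d\<^sup>2"
  using norm_bump_le[OF d_pos] by (simp add: tile_def norm_mult)

lemma FT_tile: "FT (tile q k) t = atom q k t"
proof -
  have "FT (tile q k) t = FT (\<lambda>t. bump d (t - real_of_int q * d) * cis (2 * pi * (- (real_of_int k / l)) * t)) t"
    by (simp add: tile_def[abs_def])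
  also have "\<dots> = FT (\<lambda>f. bump d (f - real_of_int q * d)) (t + - (real_of_int k / l))"
    by (rule FT_modulated)
  finally show ?thesis by (simp add: FT_shift atom_def)
qed

lemma atom_measurable [measurable]: "atom q k \<in> borel_measurable borel"
  unfolding atom_def[abs_def] by measurable

lemma norm_atom: "cmod (atom q k t) = cmod (FT (bump d) (t - real_of_int k / l))"
  by (simp add: atom_def norm_mult)

lemma isCont_spec: "isCont (spec K c i) f"
  unfolding spec_def[abs_def] by (intro continuous_intros isCont_tile)

lemma integrable_spec: "integrable lborel (spec K c i)"
  unfolding spec_def[abs_def]
  by (intro Bochner_Integration.integrable_sum integrable_mult_right integrable_tile)

lemma norm_spec_le: "\<exists>B. \<forall>f. cmod (spec K c i f) \<le> B"
proof (intro exI allI)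
  fix f
  show "cmod (spec K c i f) \<le> (\<Sum>q\<in>Q. \<Sum>k\<in>K. cmod (if i \<in> act q then c (q, i, k) else 0) * d\<^sup>2)"
    unfolding spec_def
    by (intro sum_norm_le) (auto simp: norm_mult intro!: mult_left_mono norm_tile)
qed

lemma integrable_spec_squared: "integrable lborel (\<lambda>f. (cmod (spec K c i f))\<^sup>2)"
  using norm_spec_le integrable_norm_squared[OF integrable_spec] by blast

lemma spec_outside: "f \<notin> F i \<Longrightarrow> spec K c i f = 0"
  unfolding spec_def by (intro sum.neutral ballI) (auto simp: act_def intro!: tile_outside)

lemma FT_spec: "FT (spec K c i) t = (\<Sum>q\<in>Q. \<Sum>k\<in>K. (if i \<in> act q then c (q, i, k) else 0) * atom q k t)"
  unfolding spec_def[abs_def]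
  by (simp add: FT_sum FT_cmult FT_tile integrable_tile Bochner_Integration.integrable_sum)

lemma isCont_vspec: "isCont (vspec K c v) f"
  unfolding vspec_def[abs_def] by (intro continuous_intros isCont_spec)

lemma integrable_vspec: "integrable lborel (vspec K c v)"
  unfolding vspec_def[abs_def]
  by (intro Bochner_Integration.integrable_sum integrable_mult_right integrable_spec)

lemma norm_vspec_le: "\<exists>B. \<forall>f. cmod (vspec K c v f) \<le> B"
proof -
  obtain B where B: "\<And>i f. cmod (spec K c i f) \<le> B i" using norm_spec_le by metis
  have "cmod (vspec K c v f) \<le> (\<Sum>i<N. cmod (U v i) * B i)" for f
    unfolding vspec_def by (intro sum_norm_le) (auto simp: norm_mult intro!: mult_left_mono B)
  then show ?thesis by blast
qed

lemma integrable_vspec_squared: "integrable lborel (\<lambda>f. (cmod (vspec K c v f))\<^sup>2)"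
  using norm_vspec_le integrable_norm_squared[OF integrable_vspec] by blast

lemma sig_eq:
  assumes "finite K"
  shows "sig K c v t = (\<Sum>i<N. cnj (U v i) * FT (spec K c i) t)"
proof -
  have "sig K c v t = (\<Sum>q\<in>Q. \<Sum>i\<in>act q. \<Sum>k\<in>K. cnj (U v i) * (c (q, i, k) * atom q k t))"
    unfolding sig_def idx_def using assms
    by (simp add: sum.Sigma sum.cartesian_product finite_Q mult_ac)
  also have "\<dots> = (\<Sum>q\<in>Q. \<Sum>i<N. \<Sum>k\<in>K. cnj (U v i) * ((if i \<in> act q then c (q, i, k) else 0) * atom q k t))"
    by (intro sum.cong refl sum.mono_neutral_cong_left) (auto simp: act_def)
  also have "\<dots> = (\<Sum>i<N. cnj (U v i) * FT (spec K c i) t)"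
    by (subst sum.swap) (simp add: FT_spec sum_distrib_left)
  finally show ?thesis .
qed

lemma FT_vspec:
  assumes "finite K"
  shows "FT (vspec K c v) t = sig K c v t"
  unfolding vspec_def[abs_def] sig_eq[OF assms] by (simp add: FT_sum FT_cmult integrable_spec)

text \<open>\<open>spec K c\<close> is the witness. It vanishes outside \<open>F i\<close>, so
  integrals over \<open>F i\<close> and over the whole line agree.\<close>

lemma sig_in_BL_C:
  assumes "finite K"
  shows "sig K c \<in> BL_C N U F"
  unfolding BL_C_def
proof (intro CollectI exI[of _ "spec K c"] conjI allI impI)
  fix i assume i: "i < N"
  have [measurable]: "spec K c i \<in> borel_measurable borel" using integrable_spec by auto
  show "spec K c i \<in> borel_measurable lborel" by simp
  have "integrable lborel (\<lambda>f. (cmod (spec K c i f))\<^sup>2)" by (rule integrable_spec_squared)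
  then show "set_integrable lborel (F i) (\<lambda>f. (cmod (spec K c i f))\<^sup>2)"
    unfolding set_integrable_def using F_borel[OF i] by (intro integrable_mult_indicator) auto
next
  fix v t
  have "(LINT f:F i|lborel. spec K c i f * cis (2 * pi * f * t)) = FT (spec K c i) t" for i
    unfolding FT_def set_lebesgue_integral_def
    by (intro Bochner_Integration.integral_cong) (auto simp: indicator_def spec_outside)
  then show "sig K c v t = (\<Sum>i<N. cnj (U v i) * (LINT f:F i|lborel. spec K c i f * cis (2 * pi * f * t)))"
    by (simp add: sig_eq[OF assms])
qed

text \<open>Cauchy-Schwarz separates the coefficients from the atoms; the modulus of an atom depends
  on its centre but not on its cell.\<close>

lemma norm_sig_squared_le:
  "(cmod (sig K c v t))\<^sup>2 \<le> (\<Sum>j\<in>idx K. (cmod (c j))\<^sup>2) *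
     (\<Sum>(q, i, k)\<in>idx K. (cmod (U v i))\<^sup>2 * (cmod (FT (bump d) (t - real_of_int k / l)))\<^sup>2)"
proof -
  have "sig K c v t = (\<Sum>j\<in>idx K. c j * (case j of (q, i, k) \<Rightarrow> cnj (U v i) * atom q k t))"
    unfolding sig_def by (intro sum.cong) auto
  also have "(cmod \<dots>)\<^sup>2 \<le> (\<Sum>j\<in>idx K. (cmod (c j))\<^sup>2) *
     (\<Sum>j\<in>idx K. (cmod (case j of (q, i, k) \<Rightarrow> cnj (U v i) * atom q k t))\<^sup>2)"
    by (rule norm_sum_mult_squared_le)
  also have "(\<Sum>j\<in>idx K. (cmod (case j of (q, i, k) \<Rightarrow> cnj (U v i) * atom q k t))\<^sup>2) =
      (\<Sum>(q, i, k)\<in>idx K. (cmod (U v i))\<^sup>2 * (cmod (FT (bump d) (t - real_of_int k / l)))\<^sup>2)"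
    by (intro sum.cong) (auto simp: norm_mult norm_atom power_mult_distrib)
  finally show ?thesis .
qed

lemma integrable_FT_bump_squared: "integrable lborel (\<lambda>t. (cmod (FT (bump d) (t - x)))\<^sup>2)"
proof -
  obtain C where C: "C > 0" "\<And>t. cmod (FT (bump d) t) \<le> C / (1 + t\<^sup>2)"
    using FT_bump_quadratic_decay[OF d_pos] by blast
  have "integrable lborel (\<lambda>t. (cmod (FT (bump d) t))\<^sup>2)"
  proof (rule Bochner_Integration.integrable_bound)
    show "integrable lborel (\<lambda>t::real. C * C * (1 / (1 + t\<^sup>2)))"
      by (intro integrable_mult_right integrable_inverse_one_plus_square)
    have "(cmod (FT (bump d) t))\<^sup>2 \<le> C * C * (1 / (1 + t\<^sup>2))" for t
    proof -
      have t: "1 + t\<^sup>2 \<ge> 1" "0 < 1 + t\<^sup>2" using zero_le_power2[of t] by linarith+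
      have "C / (1 + t\<^sup>2) \<le> C / 1" using t C(1) by (intro divide_left_mono) auto
      then have "cmod (FT (bump d) t) * cmod (FT (bump d) t) \<le> C * (C / (1 + t\<^sup>2))"
        using C(1) t by (intro mult_mono C order_trans[OF C(2)]) auto
      then show ?thesis by (simp add: power2_eq_square)
    qed
    then show "AE t in lborel. norm ((cmod (FT (bump d) t))\<^sup>2) \<le> norm (C * C * (1 / (1 + t\<^sup>2)))"
      by (intro AE_I2) (use order_trans[OF _ abs_ge_self] in auto)
  qed measurable
  from lborel_integrable_real_affine[OF this, of 1 "- x"] show ?thesis by simp
qed

text \<open>Needed for Plancherel's inequality: the integral of a function that is not integrable is
  0 by convention, and \<open>sig_norm2\<close> would then say nothing about the energy.\<close>

lemma integrable_sig_squared:
  assumes "finite K"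
  shows "integrable lborel (\<lambda>t. (cmod (sig K c v t))\<^sup>2)"
proof (rule Bochner_Integration.integrable_bound)
  show "integrable lborel (\<lambda>t. (\<Sum>j\<in>idx K. (cmod (c j))\<^sup>2) *
     (\<Sum>(q, i, k)\<in>idx K. (cmod (U v i))\<^sup>2 * (cmod (FT (bump d) (t - real_of_int k / l)))\<^sup>2))"
    unfolding case_prod_unfold
    by (intro integrable_mult_right Bochner_Integration.integrable_sum integrable_FT_bump_squared)
  show "AE t in lborel. norm ((cmod (sig K c v t))\<^sup>2) \<le> norm ((\<Sum>j\<in>idx K. (cmod (c j))\<^sup>2) *
     (\<Sum>(q, i, k)\<in>idx K. (cmod (U v i))\<^sup>2 * (cmod (FT (bump d) (t - real_of_int k / l)))\<^sup>2))"
    unfolding real_norm_def abs_of_nonneg[OF zero_le_power2]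
    by (intro AE_I2 order_trans[OF norm_sig_squared_le abs_ge_self])
  show "(\<lambda>t. (cmod (sig K c v t))\<^sup>2) \<in> borel_measurable lborel"
    unfolding sig_def[abs_def] case_prod_unfold by measurable
qed

text \<open>The tiles of other cells vanish here, and those of \<open>q\<close> share the bump as a
  common factor, which leaves a trigonometric sum.\<close>

lemma spec_on_cell:
  assumes q: "q \<in> Q" and i: "i \<in> act q" and f: "f \<in> cell d q"
  shows "cmod (spec K c i f) =
    cmod (bump d (f - real_of_int q * d)) * cmod (\<Sum>k\<in>K. c (q, i, k) * cis (- (2 * pi * real_of_int k / l * f)))"
proof -
  have "spec K c i f = (\<Sum>q'\<in>Q. if q' = q then (\<Sum>k\<in>K. c (q, i, k) * tile q k f) else 0)"
    unfolding spec_def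
  proof (intro sum.cong refl)
    fix q'
    have "tile q' k f = 0" if "q' \<noteq> q" for k
      using that cell_disjoint[OF d_pos f, of q'] by (intro tile_outside) auto
    then show "(\<Sum>k\<in>K. (if i \<in> act q' then c (q', i, k) else 0) * tile q' k f) =
        (if q' = q then (\<Sum>k\<in>K. c (q, i, k) * tile q k f) else 0)"
      using i by auto
  qed
  also have "\<dots> = (\<Sum>k\<in>K. c (q, i, k) * tile q k f)" using q finite_Q by simp
  also have "\<dots> = bump d (f - real_of_int q * d) * (\<Sum>k\<in>K. c (q, i, k) * cis (- (2 * pi * real_of_int k / l * f)))"
    by (simp add: tile_def sum_distrib_left mult_ac)
  finally show ?thesis by (simp add: norm_mult)
qed

text \<open>The middle interval of length \<open>l\<close> in a cell keeps the distance
  \<open>a\<close> from both ends, so the bump is at least \<open>a^2\<close> on it, and Parseval's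
  identity evaluates the exponential sum. Cells do not overlap, so their contributions add
  up.\<close>

lemma spec_norm_lower:
  assumes K: "finite K" and a: "a = (d - l) / 2"
  shows "a ^ 4 * l * (\<Sum>q\<in>{q\<in>Q. i \<in> act q}. \<Sum>k\<in>K. (cmod (c (q, i, k)))\<^sup>2) \<le> (LINT f|lborel. (cmod (spec K c i f))\<^sup>2)"
proof -
  let ?R = "{q\<in>Q. i \<in> act q}"
  let ?x = "\<lambda>q. real_of_int q * d + a"
  let ?s = "\<lambda>q f. \<Sum>k\<in>K. c (q, i, k) * cis (- (2 * pi * real_of_int k / l * f))"
  have a_pos: "a > 0" using a l_less by simp
  have sub: "f \<in> cell d q" "a \<le> f - real_of_int q * d" "f - real_of_int q * d \<le> d - a"
    if "f \<in> {?x q..?x q + l}" for q f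
    using that a a_pos l_pos by (auto simp: cell_def field_simps)
  have int: "integrable lborel (\<lambda>f. indicator {?x q..?x q + l} f * (cmod (?s q f))\<^sup>2)" for q
  proof -
    have "integrable lborel (\<lambda>f. indicator {?x q..?x q + l} f *\<^sub>R (cmod (?s q f))\<^sup>2)"
      using l_pos by (intro borel_integrable_compact) (auto intro!: continuous_intros)
    then show ?thesis by simp
  qed
  have sq: "integrable lborel (\<lambda>f. (cmod (spec K c i f))\<^sup>2)" by (rule integrable_spec_squared)
  have "a ^ 4 * l * (\<Sum>q\<in>?R. \<Sum>k\<in>K. (cmod (c (q, i, k)))\<^sup>2)
      = (\<Sum>q\<in>?R. a ^ 4 * (LINT f|lborel. indicator {?x q..?x q + l} f * (cmod (?s q f))\<^sup>2))"
    unfolding exponentials_parseval[OF l_pos K] by (simp add: sum_distrib_left mult.assoc)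
  also have "\<dots> = (LINT f|lborel. (\<Sum>q\<in>?R. a ^ 4 * (indicator {?x q..?x q + l} f * (cmod (?s q f))\<^sup>2)))"
    using int by (simp only: Bochner_Integration.integral_sum integral_mult_right_zero integrable_mult_right)
  also have "\<dots> \<le> (LINT f|lborel. (cmod (spec K c i f))\<^sup>2)"
  proof (rule integral_mono)
    fix f
    let ?g = "\<lambda>q. a ^ 4 * (indicator {?x q..?x q + l} f * (cmod (?s q f))\<^sup>2)"
    show "(\<Sum>q\<in>?R. ?g q) \<le> (cmod (spec K c i f))\<^sup>2"
    proof (cases "\<exists>q\<in>?R. f \<in> {?x q..?x q + l}")
      case True
      then obtain q where q: "q \<in> Q" "i \<in> act q" "f \<in> {?x q..?x q + l}" by blast
      have "?g q' = 0" if "q' \<noteq> q" for q'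
      proof -
        have "f \<notin> {?x q'..?x q' + l}"
          using that cell_disjoint[OF d_pos sub(1)[OF q(3)], of q'] sub(1)[of f q'] by auto
        then show ?thesis by simp
      qed
      then have "(\<Sum>q\<in>?R. ?g q) = (\<Sum>q'\<in>?R. if q' = q then ?g q else 0)"
        by (intro sum.cong) auto
      also have "\<dots> = ?g q" using q finite_Q by simp
      also have "\<dots> = (a\<^sup>2)\<^sup>2 * (cmod (?s q f))\<^sup>2" using q by simp
      also have "\<dots> \<le> (cmod (bump d (f - real_of_int q * d)))\<^sup>2 * (cmod (?s q f))\<^sup>2"
        using sub[OF q(3)] a_pos by (intro mult_right_mono power_mono norm_bump_ge) auto
      also have "\<dots> = (cmod (spec K c i f))\<^sup>2"
        by (simp add: spec_on_cell[OF q(1,2) sub(1)[OF q(3)]] power_mult_distrib)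
      finally show ?thesis .
    next
      case False
      then have "(\<Sum>q\<in>?R. ?g q) = 0" by (intro sum.neutral) auto
      then show ?thesis by simp
    qed
  qed (intro Bochner_Integration.integrable_sum integrable_mult_right int sq)+
  finally show ?thesis .
qed

end

subsection \<open>Stable samples of grid signals\<close>

text \<open>A shift in time multiplies every spectrum by a factor of modulus 1. Hence a single test
  signal can probe the samples near any point.\<close>

lemma BL_C_translate:
  assumes "X \<in> BL_C N U F"
  shows "(\<lambda>v t. X v (t - x)) \<in> BL_C N U F"
proof -
  from assms obtain g where g: "\<And>i. i < N \<Longrightarrow> g i \<in> borel_measurable lborel"
      "\<And>i. i < N \<Longrightarrow> set_integrable lborel (F i) (\<lambda>f. (cmod (g i f))\<^sup>2)"
      "\<And>v t. X v t = (\<Sum>i<N. cnj (U v i) * (LINT f:F i|lborel. g i f * cis (2 * pi * f * t)))"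
    unfolding BL_C_def by auto
  show ?thesis unfolding BL_C_def
  proof (intro CollectI exI[of _ "\<lambda>i f. g i f * cis (- 2 * pi * f * x)"] conjI allI impI)
    fix i assume i: "i < N"
    have [measurable]: "g i \<in> borel_measurable borel" using g(1)[OF i] by simp
    show "(\<lambda>f. g i f * cis (- 2 * pi * f * x)) \<in> borel_measurable lborel" by measurable
    show "set_integrable lborel (F i) (\<lambda>f. (cmod (g i f * cis (- 2 * pi * f * x)))\<^sup>2)"
      using g(2)[OF i] by (simp add: norm_mult)
  next
    fix v t
    have "g i f * cis (2 * pi * f * (t - x)) = g i f * cis (- 2 * pi * f * x) * cis (2 * pi * f * t)" for i f
      by (simp add: mult.assoc cis_mult algebra_simps)
    then show "X v (t - x) = (\<Sum>i<N. cnj (U v i) *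
        (LINT f:F i|lborel. g i f * cis (- 2 * pi * f * x) * cis (2 * pi * f * t)))"
      by (simp only: g(3))
  qed
qed

lemma sig_norm2_translate: "sig_norm2 Vs (\<lambda>v t. X v (t - x)) = sig_norm2 Vs X"
  unfolding sig_norm2_def
proof (intro sum.cong refl)
  fix v
  show "(LINT t|lborel. (cmod (X v (t - x)))\<^sup>2) = (LINT t|lborel. (cmod (X v t))\<^sup>2)"
    using lborel_integral_real_affine[of 1 "\<lambda>t. (cmod (X v t))\<^sup>2" "- x"] by simp
qed

context cell_grid
begin

text \<open>Parseval bounds the coefficients by the spectra, the left inverse \<open>L\<close>
  bounds these at each frequency by the spectra at the vertices of \<open>Vs\<close>, and
  Plancherel's inequality passes to the energy in time.\<close>

lemma energy_lower:
  fixes Vs :: "nat set" and L :: "nat \<Rightarrow> nat \<Rightarrow> complex"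
  defines "C \<equiv> {i. i < N \<and> F i \<noteq> {}}"
  assumes Vs: "finite Vs"
    and L: "\<And>x i. i \<in> C \<Longrightarrow> x i = (\<Sum>v\<in>Vs. L i v * (\<Sum>k\<in>C. U v k * x k))"
  shows "\<exists>a>0. \<forall>K c. finite K \<longrightarrow> a * (\<Sum>j\<in>idx K. (cmod (c j))\<^sup>2) \<le> sig_norm2 Vs (sig K c)"
proof -
  \<comment> \<open>The summand 1 keeps \<open>H\<close> positive for the final division.\<close>
  define H where "H = 1 + (\<Sum>i<N. \<Sum>v\<in>Vs. (cmod (L i v))\<^sup>2)"
  have H: "H > 0" unfolding H_def by (intro add_pos_nonneg sum_nonneg) auto
  define a where "a = (d - l) / 2"
  have a: "a > 0" using l_less by (simp add: a_def)
  have main: "a ^ 4 * l * (\<Sum>j\<in>idx K. (cmod (c j))\<^sup>2) \<le> H * sig_norm2 Vs (sig K c)" if K: "finite K" for K c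
  proof -
    have spec0: "spec K c i f = 0" if "F i = {}" for i f using that by (intro spec_outside) auto
    have pointwise: "(\<Sum>i<N. (cmod (spec K c i f))\<^sup>2) \<le> H * (\<Sum>v\<in>Vs. (cmod (vspec K c v f))\<^sup>2)" for f
    proof -
      let ?E = "\<Sum>v\<in>Vs. (cmod (vspec K c v f))\<^sup>2"
      have E: "?E \<ge> 0" by (intro sum_nonneg) auto
      have "(cmod (spec K c i f))\<^sup>2 \<le> (\<Sum>v\<in>Vs. (cmod (L i v))\<^sup>2) * ?E" if "i < N" for i
      proof (cases "i \<in> C")
        case True
        \<comment> \<open>Signals mix the spectra with the conjugated entries of \<open>U\<close>,
          whereas \<open>L\<close> inverts \<open>U\<close> itself; hence the passage to
          conjugates.\<close>
        have "(\<Sum>k\<in>C. U v k * cnj (spec K c k f)) = cnj (vspec K c v f)" for v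
        proof -
          have "cnj (vspec K c v f) = (\<Sum>k<N. U v k * cnj (spec K c k f))" by (simp add: vspec_def)
          also have "\<dots> = (\<Sum>k\<in>C. U v k * cnj (spec K c k f))"
            by (intro sum.mono_neutral_right) (auto simp: C_def spec0)
          finally show ?thesis ..
        qed
        then have "cnj (spec K c i f) = (\<Sum>v\<in>Vs. L i v * cnj (vspec K c v f))"
          using L[OF True, of "\<lambda>k. cnj (spec K c k f)"] by simp
        then have "(cmod (spec K c i f))\<^sup>2 = (cmod (\<Sum>v\<in>Vs. L i v * cnj (vspec K c v f)))\<^sup>2"
          by (metis complex_mod_cnj)
        also have "\<dots> \<le> (\<Sum>v\<in>Vs. (cmod (L i v))\<^sup>2) * (\<Sum>v\<in>Vs. (cmod (cnj (vspec K c v f)))\<^sup>2)"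
          by (rule norm_sum_mult_squared_le)
        finally show ?thesis by simp
      next
        case False
        then have "spec K c i f = 0" using that by (intro spec0) (auto simp: C_def)
        then show ?thesis using E by (simp add: sum_nonneg)
      qed
      then have "(\<Sum>i<N. (cmod (spec K c i f))\<^sup>2) \<le> (\<Sum>i<N. (\<Sum>v\<in>Vs. (cmod (L i v))\<^sup>2) * ?E)"
        by (intro sum_mono) auto
      also have "\<dots> \<le> H * ?E" unfolding sum_distrib_right[symmetric] H_def using E by (intro mult_right_mono) auto
      finally show ?thesis .
    qed
    have "(\<Sum>j\<in>idx K. (cmod (c j))\<^sup>2) = (\<Sum>q\<in>Q. \<Sum>i\<in>act q. \<Sum>k\<in>K. (cmod (c (q, i, k)))\<^sup>2)"
      unfolding idx_def using K by (simp add: sum.Sigma sum.cartesian_product finite_Q case_prod_unfold)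
    also have "\<dots> = (\<Sum>q\<in>Q. \<Sum>i | i < N \<and> i \<in> act q. \<Sum>k\<in>K. (cmod (c (q, i, k)))\<^sup>2)"
      by (intro sum.cong refl) (auto simp: act_def)
    also have "\<dots> = (\<Sum>i<N. \<Sum>q\<in>{q\<in>Q. i \<in> act q}. \<Sum>k\<in>K. (cmod (c (q, i, k)))\<^sup>2)"
      using sum.swap_restrict[OF finite_Q, of "{..<N}" "\<lambda>q i. \<Sum>k\<in>K. (cmod (c (q, i, k)))\<^sup>2" "\<lambda>q i. i \<in> act q"]
      by simp
    finally have "a ^ 4 * l * (\<Sum>j\<in>idx K. (cmod (c j))\<^sup>2)
        = (\<Sum>i<N. a ^ 4 * l * (\<Sum>q\<in>{q\<in>Q. i \<in> act q}. \<Sum>k\<in>K. (cmod (c (q, i, k)))\<^sup>2))"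
      by (simp only: sum_distrib_left)
    also have "\<dots> \<le> (\<Sum>i<N. LINT f|lborel. (cmod (spec K c i f))\<^sup>2)"
      by (intro sum_mono spec_norm_lower K a_def)
    also have "\<dots> = (LINT f|lborel. (\<Sum>i<N. (cmod (spec K c i f))\<^sup>2))"
      by (intro Bochner_Integration.integral_sum[symmetric] integrable_spec_squared)
    also have "\<dots> \<le> (LINT f|lborel. H * (\<Sum>v\<in>Vs. (cmod (vspec K c v f))\<^sup>2))"
      by (intro integral_mono pointwise integrable_mult_right Bochner_Integration.integrable_sum
          integrable_spec_squared integrable_vspec_squared)
    also have "\<dots> = H * (\<Sum>v\<in>Vs. LINT f|lborel. (cmod (vspec K c v f))\<^sup>2)"
      by (simp add: Bochner_Integration.integral_sum integrable_vspec_squared)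
    also have "\<dots> \<le> H * sig_norm2 Vs (sig K c)"
      unfolding sig_norm2_def
    proof (intro mult_left_mono sum_mono)
      fix v
      obtain B where B: "\<And>f. cmod (vspec K c v f) \<le> B" using norm_vspec_le by metis
      show "(LINT f|lborel. (cmod (vspec K c v f))\<^sup>2) \<le> (LINT t|lborel. (cmod (sig K c v t))\<^sup>2)"
        using FT_norm_lower[OF integrable_vspec B isCont_vspec] integrable_sig_squared[OF K]
        by (simp only: FT_vspec[OF K])
    qed (use H in simp)
    finally show ?thesis .
  qed
  show ?thesis
  proof (intro exI[of _ "a ^ 4 * l / H"] conjI allI impI)
    fix K c assume "finite (K :: int set)"
    from main[OF this, of c] show "a ^ 4 * l / H * (\<Sum>j\<in>idx K. (cmod (c j))\<^sup>2) \<le> sig_norm2 Vs (sig K c)"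
      using H by (simp add: field_simps)
  qed (use a l_pos H in simp)
qed

text \<open>An atom translated to \<open>x\<close> is bounded below at all samples of
  \<open>v\<close> within \<open>r\<close> of \<open>x\<close>, so the upper frame bound limits
  their number uniformly in \<open>x\<close>.\<close>

lemma bounded_sample_sums:
  assumes samp: "sampling_set S"
    and upper: "\<And>X. X \<in> BL_C N U F \<Longrightarrow> (\<lambda>(v, t). (cmod (X v t))\<^sup>2) summable_on S \<and>
       (\<Sum>\<^sub>\<infinity>(v, t)\<in>S. (cmod (X v t))\<^sup>2) \<le> A' * sig_norm2 Vs X"
    and qi: "q \<in> Q" "i \<in> act q" "U v i \<noteq> 0"
  shows "\<exists>C\<ge>0. \<forall>x E. finite E \<longrightarrow> E \<subseteq> {t. (v, t) \<in> S} \<longrightarrow> (\<Sum>t\<in>E. 1 / (1 + (t - x)\<^sup>2)) \<le> C"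
proof -
  \<comment> \<open>The single atom of cell \<open>q\<close> and eigen-index \<open>i\<close>
    centred at 0.\<close>
  define X where "X = sig {0} (\<lambda>j. if j = (q, i, 0) then 1 else 0)"
  have X: "X v t = cnj (U v i) * atom q 0 t" for v t
  proof -
    have "X v t = (\<Sum>j\<in>idx {0}. if j = (q, i, 0) then cnj (U v i) * atom q 0 t else 0)"
      unfolding X_def sig_def by (intro sum.cong) (auto split: if_splits)
    also have "\<dots> = cnj (U v i) * atom q 0 t"
      using qi by (simp add: idx_def finite_Q)
    finally show ?thesis .
  qed
  \<comment> \<open>The radius within which \<open>FT_bump_ge\<close> applies.\<close>
  define r where "r = 1 / (6 * d)"
  define m where "m = (cmod (U v i) * (d ^ 3 / 64))\<^sup>2"
  have m: "m > 0" using qi d_pos by (simp add: m_def)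
  have fin: "finite {t \<in> {t. (v, t) \<in> S}. \<bar>t - x\<bar> \<le> r}" for x
  proof (rule finite_subset)
    show "finite {t. (v, t) \<in> S \<and> - (\<bar>x\<bar> + r) \<le> t \<and> t \<le> \<bar>x\<bar> + r}"
      using samp unfolding sampling_set_def by blast
  qed auto
  have "real (card {t \<in> {t. (v, t) \<in> S}. \<bar>t - x\<bar> \<le> r}) \<le> A' * sig_norm2 Vs X / m" for x
  proof -
    let ?B = "{t \<in> {t. (v, t) \<in> S}. \<bar>t - x\<bar> \<le> r}"
    let ?Y = "\<lambda>v t. X v (t - x)"
    have Y: "?Y \<in> BL_C N U F" unfolding X_def by (intro BL_C_translate sig_in_BL_C) simp
    have "real (card ?B) * m = (\<Sum>t\<in>?B. m)" by simp
    also have "\<dots> \<le> (\<Sum>t\<in>?B. (cmod (?Y v t))\<^sup>2)"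
      unfolding m_def
    proof (intro sum_mono power_mono)
      fix t assume t: "t \<in> ?B"
      then have "d ^ 3 / 64 \<le> cmod (FT (bump d) (t - x))"
        by (intro FT_bump_ge d_pos) (auto simp: r_def)
      then have "cmod (U v i) * (d ^ 3 / 64) \<le> cmod (U v i) * cmod (FT (bump d) (t - x))"
        by (rule mult_left_mono) simp
      then show "cmod (U v i) * (d ^ 3 / 64) \<le> cmod (?Y v t)"
        by (simp add: X norm_mult norm_atom)
    qed (use d_pos in simp)
    also have "\<dots> = (\<Sum>(v, t)\<in>{v} \<times> ?B. (cmod (?Y v t))\<^sup>2)"
      by (simp flip: sum.cartesian_product)
    also have "\<dots> \<le> (\<Sum>\<^sub>\<infinity>(v, t)\<in>S. (cmod (?Y v t))\<^sup>2)"
      using upper[OF Y] fin by (intro finite_sum_le_infsum) auto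
    also have "\<dots> \<le> A' * sig_norm2 Vs ?Y" using upper[OF Y] by simp
    also have "sig_norm2 Vs ?Y = sig_norm2 Vs X" by (rule sig_norm2_translate)
    finally show ?thesis using m by (simp add: field_simps)
  qed
  then show ?thesis using d_pos fin by (intro separated_quadratic_sum[of r]) (auto simp: r_def)
qed

text \<open>The weight makes one bound serve all vertices: where \<open>U v i = 0\<close> the sample
  count may be out of control, but the term vanishes.\<close>

lemma bounded_weighted_sample_sums:
  assumes samp: "sampling_set S"
    and upper: "\<And>X. X \<in> BL_C N U F \<Longrightarrow> (\<lambda>(v, t). (cmod (X v t))\<^sup>2) summable_on S \<and>
       (\<Sum>\<^sub>\<infinity>(v, t)\<in>S. (cmod (X v t))\<^sup>2) \<le> A' * sig_norm2 Vs X"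
    and S: "S \<subseteq> Vs \<times> UNIV" "finite Vs"
  shows "\<exists>H\<ge>0. \<forall>q\<in>Q. \<forall>i\<in>act q. \<forall>x E. finite E \<longrightarrow> E \<subseteq> S \<longrightarrow>
    (\<Sum>(v, t)\<in>E. (cmod (U v i))\<^sup>2 * (1 / (1 + (t - x)\<^sup>2))) \<le> H"
proof -
  have "\<forall>v. \<exists>C\<ge>0. (\<exists>q\<in>Q. \<exists>i\<in>act q. U v i \<noteq> 0) \<longrightarrow>
     (\<forall>x E. finite E \<longrightarrow> E \<subseteq> {t. (v, t) \<in> S} \<longrightarrow> (\<Sum>t\<in>E. 1 / (1 + (t - x)\<^sup>2)) \<le> C)"
    using bounded_sample_sums[OF samp upper] by (metis order_refl)
  then obtain C where C: "\<And>v. C v \<ge> 0" "\<And>v q i x E. q \<in> Q \<Longrightarrow> i \<in> act q \<Longrightarrow> U v i \<noteq> 0 \<Longrightarrow> finite E \<Longrightarrow>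
     E \<subseteq> {t. (v, t) \<in> S} \<Longrightarrow> (\<Sum>t\<in>E. 1 / (1 + (t - x)\<^sup>2)) \<le> C v"
    by metis
  define H where "H = (\<Sum>i<N. \<Sum>v\<in>Vs. (cmod (U v i))\<^sup>2 * C v)"
  show ?thesis
  proof (intro exI[of _ H] conjI ballI allI impI)
    show "H \<ge> 0" unfolding H_def using C by (intro sum_nonneg mult_nonneg_nonneg) auto
    fix q i x E
    assume q: "q \<in> Q" and i: "i \<in> act q" and E: "finite E" "E \<subseteq> S"
    let ?E = "\<lambda>v. {t. (v, t) \<in> E}"
    have fE: "finite (?E v)" for v
      by (rule finite_subset[of _ "snd ` E"]) (use E in force, use E in auto)
    have "E = (SIGMA v:Vs. ?E v)" using E S by auto
    then have "(\<Sum>(v, t)\<in>E. (cmod (U v i))\<^sup>2 * (1 / (1 + (t - x)\<^sup>2)))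
        = (\<Sum>v\<in>Vs. \<Sum>t\<in>?E v. (cmod (U v i))\<^sup>2 * (1 / (1 + (t - x)\<^sup>2)))"
      using S fE by (simp add: sum.Sigma)
    also have "\<dots> \<le> (\<Sum>v\<in>Vs. (cmod (U v i))\<^sup>2 * C v)"
    proof (rule sum_mono)
      fix v
      show "(\<Sum>t\<in>?E v. (cmod (U v i))\<^sup>2 * (1 / (1 + (t - x)\<^sup>2))) \<le> (cmod (U v i))\<^sup>2 * C v"
      proof (cases "U v i = 0")
        case False
        have "?E v \<subseteq> {t. (v, t) \<in> S}" using E by auto
        from C(2)[OF q i False fE this] show ?thesis
          unfolding sum_distrib_left[symmetric] by (intro mult_left_mono) auto
      qed simp
    qed
    also have "\<dots> \<le> H" unfolding H_def using i C(1)
      by (intro member_le_sum[of i "{..<N}" "\<lambda>i. \<Sum>v\<in>Vs. (cmod (U v i))\<^sup>2 * C v"]) (auto simp: act_def intro!: sum_nonneg mult_nonneg_nonneg)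
    finally show "(\<Sum>(v, t)\<in>E. (cmod (U v i))\<^sup>2 * (1 / (1 + (t - x)\<^sup>2))) \<le> H" .
  qed
qed

section \<open>Samples far from all centres\<close>

lemma card_idx: "finite K \<Longrightarrow> card (idx K) = card K * (\<Sum>q\<in>Q. card (act q))"
  unfolding idx_def by (simp add: card_SigmaI finite_Q card_cartesian_product sum_distrib_left mult.commute)

text \<open>Samples beyond \<open>T\<close> keep the distance \<open>R\<close> from every centre. Of
  the two decay factors in the square of an atom, one yields \<open>1 / R^2\<close> and the other
  stays summable over the samples. With \<open>card K\<close> and \<open>R\<close> both linear in
  \<open>T\<close>, the tail becomes negligible against the coefficients.\<close>

lemma tail_bound:
  assumes samp: "sampling_set S"
    and upper: "\<And>X. X \<in> BL_C N U F \<Longrightarrow> (\<lambda>(v, t). (cmod (X v t))\<^sup>2) summable_on S \<and>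
       (\<Sum>\<^sub>\<infinity>(v, t)\<in>S. (cmod (X v t))\<^sup>2) \<le> A' * sig_norm2 Vs X"
    and S: "S \<subseteq> Vs \<times> UNIV" "finite Vs"
  shows "\<exists>D\<ge>0. \<forall>K c T R. finite K \<longrightarrow> R > 0 \<longrightarrow>
     (\<forall>k\<in>K. \<forall>t. T < \<bar>t\<bar> \<longrightarrow> R \<le> \<bar>t - real_of_int k / l\<bar>) \<longrightarrow>
     (\<forall>(v, t)\<in>S. \<bar>t\<bar> \<le> T \<longrightarrow> sig K c v t = 0) \<longrightarrow>
     (\<Sum>\<^sub>\<infinity>(v, t)\<in>S. (cmod (sig K c v t))\<^sup>2) \<le> real (card K) * D / R\<^sup>2 * (\<Sum>j\<in>idx K. (cmod (c j))\<^sup>2)"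
proof -
  obtain H where H: "H \<ge> 0" "\<And>q i x E. q \<in> Q \<Longrightarrow> i \<in> act q \<Longrightarrow> finite E \<Longrightarrow> E \<subseteq> S \<Longrightarrow>
    (\<Sum>(v, t)\<in>E. (cmod (U v i))\<^sup>2 * (1 / (1 + (t - x)\<^sup>2))) \<le> H"
    using bounded_weighted_sample_sums[OF samp upper S] by metis
  obtain C where C: "C > 0" "\<And>t. cmod (FT (bump d) t) \<le> C / (1 + t\<^sup>2)"
    using FT_bump_quadratic_decay[OF d_pos] by blast
  define D where "D = (\<Sum>q\<in>Q. real (card (act q))) * C\<^sup>2 * H"
  show ?thesis
  proof (intro exI[of _ D] conjI allI impI)
    show "D \<ge> 0" using H C by (simp add: D_def sum_nonneg)
    fix K c T and R :: real
    assume K: "finite K" and R: "R > 0"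
      and far: "\<forall>k\<in>K. \<forall>t. T < \<bar>t\<bar> \<longrightarrow> R \<le> \<bar>t - real_of_int k / l\<bar>"
      and zero: "\<forall>(v, t)\<in>S. \<bar>t\<bar> \<le> T \<longrightarrow> sig K c v t = 0"
    let ?c = "\<Sum>j\<in>idx K. (cmod (c j))\<^sup>2"
    have c: "?c \<ge> 0" by (intro sum_nonneg) auto
    show "(\<Sum>\<^sub>\<infinity>(v, t)\<in>S. (cmod (sig K c v t))\<^sup>2) \<le> real (card K) * D / R\<^sup>2 * ?c"
    proof (rule infsum_le_finite_sums)
      show "(\<lambda>(v, t). (cmod (sig K c v t))\<^sup>2) summable_on S"
        using upper[OF sig_in_BL_C[OF K]] by simp
      fix E assume E: "finite E" "E \<subseteq> S"
      define E' where "E' = {(v, t)\<in>E. T < \<bar>t\<bar>}"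
      have "E' \<subseteq> E" by (auto simp: E'_def)
      then have E': "finite E'" "E' \<subseteq> S" using E finite_subset by auto
      have "(\<Sum>(v, t)\<in>E. (cmod (sig K c v t))\<^sup>2) = (\<Sum>(v, t)\<in>E'. (cmod (sig K c v t))\<^sup>2)"
        using E zero by (intro sum.mono_neutral_right) (force simp: E'_def not_less)+
      also have "\<dots> \<le> (\<Sum>(v, t)\<in>E'. ?c * (\<Sum>(q, i, k)\<in>idx K. (cmod (U v i))\<^sup>2 * (cmod (FT (bump d) (t - real_of_int k / l)))\<^sup>2))"
        by (intro sum_mono) (auto intro: norm_sig_squared_le)
      also have "\<dots> = ?c * (\<Sum>(q, i, k)\<in>idx K. \<Sum>(v, t)\<in>E'. (cmod (U v i))\<^sup>2 * (cmod (FT (bump d) (t - real_of_int k / l)))\<^sup>2)"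
        unfolding case_prod_unfold sum_distrib_left[symmetric] by (subst sum.swap) simp
      also have "\<dots> \<le> ?c * (\<Sum>(q, i, k)\<in>idx K. C\<^sup>2 * H / R\<^sup>2)"
      proof (intro mult_left_mono c sum_mono)
        fix j assume j: "j \<in> idx K"
        obtain q i k where qik: "j = (q, i, k)" "q \<in> Q" "i \<in> act q" "k \<in> K"
          using j by (auto simp: idx_def)
        have "(\<Sum>(v, t)\<in>E'. (cmod (U v i))\<^sup>2 * (cmod (FT (bump d) (t - real_of_int k / l)))\<^sup>2)
          \<le> (\<Sum>(v, t)\<in>E'. C\<^sup>2 / R\<^sup>2 * ((cmod (U v i))\<^sup>2 * (1 / (1 + (t - real_of_int k / l)\<^sup>2))))"
        proof (intro sum_mono, clarify)
          fix v t assume "(v, t) \<in> E'"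
          then have far': "R \<le> \<bar>t - real_of_int k / l\<bar>" using far qik by (auto simp: E'_def)
          define u where "u = t - real_of_int k / l"
          have u: "R\<^sup>2 \<le> 1 + u\<^sup>2" "0 < 1 + u\<^sup>2"
            using power_mono[OF far', of 2] R zero_le_power2[of u] by (simp_all add: u_def add_pos_nonneg)
          have "C / (1 + u\<^sup>2) \<le> C / R\<^sup>2" using u R C by (intro divide_left_mono mult_pos_pos) auto
          then have "cmod (FT (bump d) u) * cmod (FT (bump d) u) \<le> (C / R\<^sup>2) * (C / (1 + u\<^sup>2))"
            using C(1) R by (intro mult_mono C(2) order_trans[OF C(2)]) auto
          then have "(cmod (FT (bump d) u))\<^sup>2 \<le> C\<^sup>2 / R\<^sup>2 * (1 / (1 + u\<^sup>2))"
            by (simp add: power2_eq_square)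
          then have "(cmod (U v i))\<^sup>2 * (cmod (FT (bump d) u))\<^sup>2 \<le> (cmod (U v i))\<^sup>2 * (C\<^sup>2 / R\<^sup>2 * (1 / (1 + u\<^sup>2)))"
            by (intro mult_left_mono) auto
          then show "(cmod (U v i))\<^sup>2 * (cmod (FT (bump d) (t - real_of_int k / l)))\<^sup>2
             \<le> C\<^sup>2 / R\<^sup>2 * ((cmod (U v i))\<^sup>2 * (1 / (1 + (t - real_of_int k / l)\<^sup>2)))"
            by (simp only: u_def mult_ac)
        qed
        also have "\<dots> = C\<^sup>2 / R\<^sup>2 * (\<Sum>(v, t)\<in>E'. (cmod (U v i))\<^sup>2 * (1 / (1 + (t - real_of_int k / l)\<^sup>2)))"
          by (simp only: case_prod_unfold sum_distrib_left)
        also have "\<dots> \<le> C\<^sup>2 / R\<^sup>2 * H"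
          by (intro mult_left_mono H(2)[OF qik(2,3) E']) auto
        finally show "(case j of (q, i, k) \<Rightarrow> \<Sum>(v, t)\<in>E'. (cmod (U v i))\<^sup>2 * (cmod (FT (bump d) (t - real_of_int k / l)))\<^sup>2)
            \<le> (case j of (q, i, k) \<Rightarrow> C\<^sup>2 * H / R\<^sup>2)"
          by (simp add: qik(1))
      qed
      also have "\<dots> = real (card K) * D / R\<^sup>2 * ?c"
        by (simp add: card_idx[OF K] D_def case_prod_unfold)
      finally show "(\<Sum>(v, t)\<in>E. (cmod (sig K c v t))\<^sup>2) \<le> real (card K) * D / R\<^sup>2 * ?c" .
    qed
  qed
qed

section \<open>Counting unknowns against equations\<close>

lemma sig_eq_zero:
  assumes "finite K" "\<And>q k. q \<in> Q \<Longrightarrow> k \<in> K \<Longrightarrow> (\<Sum>i\<in>act q. cnj (U v i) * c (q, i, k)) = 0"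
  shows "sig K c v t = 0"
proof -
  have "sig K c v t = (\<Sum>q\<in>Q. \<Sum>i\<in>act q. \<Sum>k\<in>K. atom q k t * (cnj (U v i) * c (q, i, k)))"
    unfolding sig_def idx_def using assms(1)
    by (simp add: sum.Sigma sum.cartesian_product finite_Q mult_ac)
  also have "\<dots> = (\<Sum>q\<in>Q. \<Sum>k\<in>K. atom q k t * (\<Sum>i\<in>act q. cnj (U v i) * c (q, i, k)))"
    unfolding sum_distrib_left by (intro sum.cong refl sum.swap)
  also have "\<dots> = 0" using assms(2) by simp
  finally show ?thesis .
qed

text \<open>Each point of \<open>P\<close> costs one equation. Vanishing on \<open>V\<close> is
  imposed separately for each cell and time shift, where the rows \<open>V\<close> of
  \<open>U\<close> must annihilate the conjugated coefficients over \<open>act q\<close>; this costs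
  as many equations as the rank.\<close>

lemma vanishing_signal_exists:
  assumes K: "finite K" and P: "finite P" and V: "V \<subseteq> {..<N}"
    and less: "card P + card K * (\<Sum>q\<in>Q. mat_rank (Usub N U V (act q))) < card (idx K)"
  shows "\<exists>c. (\<exists>j\<in>idx K. c j \<noteq> 0) \<and> (\<forall>(v, t)\<in>P. sig K c v t = 0) \<and> (\<forall>v\<in>V. \<forall>t. sig K c v t = 0)"
proof -
  let ?r = "\<lambda>q. mat_rank (Usub N U V (act q))"
  have "\<forall>q. \<exists>R. \<forall>x. (\<forall>j<?r q. (\<Sum>i\<in>act q. R j i * x i) = 0) \<longrightarrow> (\<forall>v\<in>V. (\<Sum>i\<in>act q. U v i * x i) = 0)"
    by (intro allI rank_many_equations V) (auto simp: act_def)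
  then obtain R where R: "\<And>q x. (\<forall>j<?r q. (\<Sum>i\<in>act q. R q j i * x i) = 0) \<Longrightarrow>
      (\<forall>v\<in>V. (\<Sum>i\<in>act q. U v i * x i) = 0)" by metis
  \<comment> \<open>Left summands are sample points; right summands are triples of a cell, a row of
    its rank factor, and a time shift.\<close>
  define E where "E = P <+> (SIGMA q:Q. {..<?r q} \<times> K)"
  define a where "a e u = (case u of (q, i, k) \<Rightarrow> case e of Inl (v, t) \<Rightarrow> cnj (U v i) * atom q k t
     | Inr (q', j, k') \<Rightarrow> if q = q' \<and> k = k' then cnj (R q j i) else 0)" for e u
  have fE: "finite E" using P K finite_Q by (auto simp: E_def)
  have "card E = card P + card K * (\<Sum>q\<in>Q. ?r q)"
    unfolding E_def using P K finite_Q
    by (subst card_Plus) (auto simp: card_SigmaI card_cartesian_product sum_distrib_left mult.commute)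
  with less underdetermined_system[OF fE finite_idx[OF K], of a] obtain c where
    c: "\<exists>j\<in>idx K. c j \<noteq> 0" "\<And>e. e \<in> E \<Longrightarrow> (\<Sum>u\<in>idx K. a e u * c u) = 0" by auto
  have "sig K c v t = 0" if "(v, t) \<in> P" for v t
  proof -
    have "sig K c v t = (\<Sum>u\<in>idx K. a (Inl (v, t)) u * c u)"
      unfolding sig_def by (intro sum.cong) (auto simp: a_def)
    also have "\<dots> = 0" using that by (intro c) (auto simp: E_def)
    finally show ?thesis .
  qed
  moreover have "sig K c v t = 0" if v: "v \<in> V" for v t
  proof (rule sig_eq_zero[OF K])
    fix q k assume q: "q \<in> Q" and k: "k \<in> K"
    have "(\<Sum>i\<in>act q. R q j i * cnj (c (q, i, k))) = 0" if j: "j < ?r q" for j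
    proof -
      have "0 = (\<Sum>u\<in>idx K. a (Inr (q, j, k)) u * c u)"
        using q k j by (intro c(2)[symmetric]) (auto simp: E_def)
      \<comment> \<open>Only unknowns with this cell and this time shift occur in the
        equation.\<close>
      also have "\<dots> = (\<Sum>u\<in>(\<lambda>i. (q, i, k)) ` act q. a (Inr (q, j, k)) u * c u)"
        using q k K finite_idx[OF K] by (intro sum.mono_neutral_right) (auto simp: idx_def a_def)
      also have "\<dots> = (\<Sum>i\<in>act q. cnj (R q j i) * c (q, i, k))"
        by (subst sum.reindex) (auto simp: inj_on_def a_def)
      \<comment> \<open>The equations use conjugated rows to match the signal; conjugating back
        gives the form in which \<open>R\<close> controls \<open>U\<close>.\<close>
      finally have "cnj (\<Sum>i\<in>act q. cnj (R q j i) * c (q, i, k)) = cnj 0" by simp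
      then show ?thesis by simp
    qed
    then have "(\<Sum>i\<in>act q. U v i * cnj (c (q, i, k))) = 0" using R[of q "\<lambda>i. cnj (c (q, i, k))"] v by auto
    then have "cnj (\<Sum>i\<in>act q. U v i * cnj (c (q, i, k))) = cnj 0" by simp
    then show "(\<Sum>i\<in>act q. cnj (U v i) * c (q, i, k)) = 0" by simp
  qed
  ultimately show ?thesis using c(1) by (intro exI[of _ c]) auto
qed

text \<open>Otherwise some nonzero signal would vanish at all samples up to \<open>T\<close>. The
  lower frame bound keeps its sampled energy at least \<open>A * a\<close> times that of the
  coefficients, and the tail bound contradicts this as soon as \<open>card K\<close> is below
  \<open>g * R^2\<close>.\<close>

lemma sample_count:
  fixes S :: "(nat \<times> real) set"
  assumes Vs: "Vs \<subseteq> {..<N}" and \<Theta>: "\<Theta> \<subseteq> Vs"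
    and card: "card Vs = card {i. i < N \<and> F i \<noteq> {}}"
    and rank: "mat_rank (Usub N U Vs {i. i < N \<and> F i \<noteq> {}}) = card {i. i < N \<and> F i \<noteq> {}}"
    and S: "S \<subseteq> Vs \<times> UNIV" and stable: "stable_sampling S Vs (BL_C N U F)"
  shows "\<exists>g>0. \<forall>K T R. finite K \<longrightarrow> R > 0 \<longrightarrow>
     (\<forall>k\<in>K. \<forall>t. T < \<bar>t\<bar> \<longrightarrow> R \<le> \<bar>t - real_of_int k / l\<bar>) \<longrightarrow> real (card K) < g * R\<^sup>2 \<longrightarrow>
     card K * (\<Sum>q\<in>Q. card (act q)) \<le>
       card {(v, t)\<in>S. v \<in> \<Theta> \<and> \<bar>t\<bar> \<le> T} + card K * (\<Sum>q\<in>Q. mat_rank (Usub N U (Vs - \<Theta>) (act q)))"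
proof -
  let ?C = "{i. i < N \<and> F i \<noteq> {}}"
  have fVs: "finite Vs" using Vs finite_subset by blast
  obtain A A' where samp: "sampling_set S" and A: "A > 0" and
    frame: "\<And>X. X \<in> BL_C N U F \<Longrightarrow> (\<lambda>(v, t). (cmod (X v t))\<^sup>2) summable_on S \<and>
       A * sig_norm2 Vs X \<le> (\<Sum>\<^sub>\<infinity>(v, t)\<in>S. (cmod (X v t))\<^sup>2) \<and>
       (\<Sum>\<^sub>\<infinity>(v, t)\<in>S. (cmod (X v t))\<^sup>2) \<le> A' * sig_norm2 Vs X"
    using stable unfolding stable_sampling_def by auto
  obtain L where "\<And>x i. i \<in> ?C \<Longrightarrow> x i = (\<Sum>v\<in>Vs. L i v * (\<Sum>k\<in>?C. U v k * x k))"
    using full_rank_left_inverse[OF Vs _ card rank] by blast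
  from energy_lower[OF fVs this] obtain a where a: "a > 0"
    "\<And>K c. finite K \<Longrightarrow> a * (\<Sum>j\<in>idx K. (cmod (c j))\<^sup>2) \<le> sig_norm2 Vs (sig K c)" by blast
  have upper: "(\<lambda>(v, t). (cmod (X v t))\<^sup>2) summable_on S \<and>
       (\<Sum>\<^sub>\<infinity>(v, t)\<in>S. (cmod (X v t))\<^sup>2) \<le> A' * sig_norm2 Vs X" if "X \<in> BL_C N U F" for X
    using frame[OF that] by simp
  obtain D where D0: "D \<ge> 0" and D: "\<forall>K c T R. finite K \<longrightarrow> R > 0 \<longrightarrow>
     (\<forall>k\<in>K. \<forall>t. T < \<bar>t\<bar> \<longrightarrow> R \<le> \<bar>t - real_of_int k / l\<bar>) \<longrightarrow>
     (\<forall>(v, t)\<in>S. \<bar>t\<bar> \<le> T \<longrightarrow> sig K c v t = 0) \<longrightarrow>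
     (\<Sum>\<^sub>\<infinity>(v, t)\<in>S. (cmod (sig K c v t))\<^sup>2) \<le> real (card K) * D / R\<^sup>2 * (\<Sum>j\<in>idx K. (cmod (c j))\<^sup>2)"
    using tail_bound[OF samp upper S fVs] by blast
  show ?thesis
  \<comment> \<open>The added 1 keeps the quotient positive when \<open>D = 0\<close>.\<close>
  proof (intro exI[of _ "A * a / (D + 1)"] conjI allI impI)
    show "0 < A * a / (D + 1)" using A a D0 by simp
    fix K T and R :: real
    assume K: "finite K" and R: "R > 0"
      and far: "\<forall>k\<in>K. \<forall>t. T < \<bar>t\<bar> \<longrightarrow> R \<le> \<bar>t - real_of_int k / l\<bar>"
      and small: "real (card K) < A * a / (D + 1) * R\<^sup>2"
    let ?P = "{(v, t)\<in>S. v \<in> \<Theta> \<and> \<bar>t\<bar> \<le> T}"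
    have P: "finite ?P"
    proof (rule finite_subset)
      show "?P \<subseteq> (SIGMA v:Vs. {t. (v, t) \<in> S \<and> - T \<le> t \<and> t \<le> T})" using \<Theta> by auto
      show "finite (SIGMA v:Vs. {t. (v, t) \<in> S \<and> - T \<le> t \<and> t \<le> T})"
        using samp fVs by (auto simp: sampling_set_def)
    qed
    have V: "Vs - \<Theta> \<subseteq> {..<N}" using Vs by auto
    show "card K * (\<Sum>q\<in>Q. card (act q)) \<le>
       card ?P + card K * (\<Sum>q\<in>Q. mat_rank (Usub N U (Vs - \<Theta>) (act q)))"
    proof (rule ccontr)
      assume "\<not> ?thesis"
      then have "card ?P + card K * (\<Sum>q\<in>Q. mat_rank (Usub N U (Vs - \<Theta>) (act q))) < card (idx K)"
        by (simp add: card_idx[OF K])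
      from vanishing_signal_exists[OF K P V this] obtain c where c: "\<exists>j\<in>idx K. c j \<noteq> 0"
        "\<forall>(v, t)\<in>?P. sig K c v t = 0" "\<forall>v\<in>Vs - \<Theta>. \<forall>t. sig K c v t = 0" by blast
      let ?c = "\<Sum>j\<in>idx K. (cmod (c j))\<^sup>2"
      have cpos: "?c > 0" using c(1) K by (auto intro: sum_pos2)
      have zero: "\<forall>(v, t)\<in>S. \<bar>t\<bar> \<le> T \<longrightarrow> sig K c v t = 0"
      proof clarify
        fix v t assume vt: "(v, t) \<in> S" "\<bar>t\<bar> \<le> T"
        then have "v \<in> Vs" using S by auto
        show "sig K c v t = 0"
        proof (cases "v \<in> \<Theta>")
          case True
          then have "(v, t) \<in> ?P" using vt by simp
          then show ?thesis using c(2) by blast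
        next
          case False
          then show ?thesis using c(3) \<open>v \<in> Vs\<close> by blast
        qed
      qed
      have "A * (a * ?c) \<le> A * sig_norm2 Vs (sig K c)" using A a(2)[OF K] by (intro mult_left_mono) auto
      also have "\<dots> \<le> (\<Sum>\<^sub>\<infinity>(v, t)\<in>S. (cmod (sig K c v t))\<^sup>2)" using frame[OF sig_in_BL_C[OF K]] by blast
      also have "\<dots> \<le> real (card K) * D / R\<^sup>2 * ?c" using D K R far zero by blast
      finally have "(A * a) * ?c \<le> (real (card K) * D / R\<^sup>2) * ?c" by (simp only: mult.assoc)
      then have "A * a \<le> real (card K) * D / R\<^sup>2" using cpos by (rule mult_right_le_imp_le)
      also have "\<dots> \<le> real (card K) * (D + 1) / R\<^sup>2" by (intro divide_right_mono mult_left_mono) auto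
      also have "\<dots> < A * a" using small D0 R by (simp add: field_simps)
      finally show False by simp
    qed
  qed
qed

end

subsection \<open>Approximating the bands by a grid\<close>

text \<open>Membership in an interval can change only at an end point; the set \<open>{a, b}\<close>
  serves all the forms at once.\<close>

lemma interval_jump_points:
  fixes K :: "real set"
  assumes "is_interval K"
  shows "\<exists>P. finite P \<and> (\<forall>x y. x \<le> y \<longrightarrow> {x..y} \<inter> P = {} \<longrightarrow> (x \<in> K \<longleftrightarrow> y \<in> K))"
proof -
  obtain a b where "K = {} \<or> K = UNIV \<or> K = {..<b} \<or> K = {..b} \<or> K = {a<..} \<or> K = {a..} \<or>
      K = {a<..<b} \<or> K = {a<..b} \<or> K = {a..<b} \<or> K = {a..b}"
    using is_real_interval[OF assms] by blast
  then have "\<forall>x y. x \<le> y \<longrightarrow> {x..y} \<inter> {a, b} = {} \<longrightarrow> (x \<in> K \<longleftrightarrow> y \<in> K)"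
    by (elim disjE) auto
  then show ?thesis by (intro exI[of _ "{a, b}"]) simp
qed

lemma finite_union_jump_points:
  assumes "finite_union_of_intervals S"
  shows "\<exists>P. finite P \<and> (\<forall>x y. x \<le> y \<longrightarrow> {x..y} \<inter> P = {} \<longrightarrow> (x \<in> S \<longleftrightarrow> y \<in> S))"
proof -
  obtain \<K> where K: "finite \<K>" "\<And>K. K \<in> \<K> \<Longrightarrow> is_interval K" "S = \<Union>\<K>"
    using assms by (auto simp: finite_union_of_intervals_def)
  have "\<forall>K\<in>\<K>. \<exists>P. finite P \<and> (\<forall>x y. x \<le> y \<longrightarrow> {x..y} \<inter> P = {} \<longrightarrow> (x \<in> K \<longleftrightarrow> y \<in> K))"
    using K(2) interval_jump_points by blast
  then obtain P where P: "\<And>K. K \<in> \<K> \<Longrightarrow> finite (P K)"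
    "\<And>K x y. K \<in> \<K> \<Longrightarrow> x \<le> y \<Longrightarrow> {x..y} \<inter> P K = {} \<Longrightarrow> (x \<in> K \<longleftrightarrow> y \<in> K)" by metis
  show ?thesis
  proof (intro exI conjI allI impI)
    show "finite (\<Union>K\<in>\<K>. P K)" using K P by auto
    fix x y :: real assume "x \<le> y" "{x..y} \<inter> (\<Union>K\<in>\<K>. P K) = {}"
    then have "x \<in> K \<longleftrightarrow> y \<in> K" if "K \<in> \<K>" for K using that by (intro P) auto
    then show "x \<in> S \<longleftrightarrow> y \<in> S" by (auto simp: K(3))
  qed
qed

lemma finite_union_borel:
  assumes "finite_union_of_intervals S"
  shows "S \<in> sets borel"
proof -
  obtain \<K> where K: "finite \<K>" "\<And>K. K \<in> \<K> \<Longrightarrow> is_interval K" "S = \<Union>\<K>"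
    using assms by (auto simp: finite_union_of_intervals_def)
  show ?thesis unfolding K(3)
    using K by (intro sets.finite_Union) (auto intro: real_interval_borel_measurable)
qed

text \<open>The segment between two points of \<open>K\<close> lies in \<open>K\<close>, so its
  length is at most the measure of \<open>K\<close>.\<close>

lemma finite_measure_interval_bounded:
  fixes K :: "real set"
  assumes K: "is_interval K" and fin: "emeasure lborel K < \<infinity>"
  shows "bounded K"
proof (cases "K = {}")
  case False
  then obtain x where x: "x \<in> K" by auto
  have meas: "K \<in> sets lborel" using real_interval_borel_measurable[OF K] by simp
  have "\<bar>y - x\<bar> \<le> measure lborel K" if y: "y \<in> K" for y
  proof -
    have sub: "{min x y..max x y} \<subseteq> K"
    proof
      fix z assume "z \<in> {min x y..max x y}"
      moreover have "min x y \<in> K" "max x y \<in> K" using x y by (simp_all add: min_def max_def)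
      ultimately show "z \<in> K" using mem_is_interval_1_I[OF K] by (metis atLeastAtMost_iff)
    qed
    have "\<bar>y - x\<bar> = measure lborel {min x y..max x y}" by (simp add: min_def max_def)
    also have "\<dots> \<le> measure lborel K"
      using sub meas fin by (intro measure_mono_fmeasurable) (auto simp: fmeasurable_def)
    finally show ?thesis .
  qed
  then show ?thesis
    unfolding bounded_def by (intro exI[of _ x] exI) (auto simp: dist_real_def abs_minus_commute)
qed simp

lemma finite_measure_union_bounded:
  assumes S: "finite_union_of_intervals S" and fin: "emeasure lborel S < \<infinity>"
  shows "bounded S"
proof -
  obtain \<K> where K: "finite \<K>" "\<And>K. K \<in> \<K> \<Longrightarrow> is_interval K" "S = \<Union>\<K>"
    using S by (auto simp: finite_union_of_intervals_def)
  have "bounded K" if "K \<in> \<K>" for K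
  proof (rule finite_measure_interval_bounded[OF K(2)[OF that]])
    have "emeasure lborel K \<le> emeasure lborel S"
      using that finite_union_borel[OF S] by (intro emeasure_mono) (auto simp: K(3))
    then show "emeasure lborel K < \<infinity>" using fin by (rule le_less_trans)
  qed
  then show ?thesis unfolding K(3) using K(1) by (intro bounded_Union) auto
qed

text \<open>Choosing a point of \<open>P\<close> in each such cell is injective because cells are
  disjoint. The bound is free of \<open>d\<close>, so the measure lost in these cells vanishes with
  the mesh.\<close>

lemma card_cells_meeting_le:
  assumes d: "d > 0" and P: "finite P"
  shows "card {q\<in>A. cell d q \<inter> P \<noteq> {}} \<le> card P"
proof -
  have "\<forall>q\<in>{q\<in>A. cell d q \<inter> P \<noteq> {}}. \<exists>x. x \<in> cell d q \<inter> P" by auto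
  then obtain x where x: "\<And>q. q \<in> {q\<in>A. cell d q \<inter> P \<noteq> {}} \<Longrightarrow> x q \<in> cell d q \<inter> P" by metis
  show ?thesis
  proof (rule card_inj_on_le[OF _ _ P])
    show "inj_on x {q\<in>A. cell d q \<inter> P \<noteq> {}}"
    proof (rule inj_onI)
      fix q q' assume q: "q \<in> {q\<in>A. cell d q \<inter> P \<noteq> {}}" "q' \<in> {q\<in>A. cell d q \<inter> P \<noteq> {}}" "x q = x q'"
      have "x q \<in> cell d q" "x q \<in> cell d q'" using x[OF q(1)] x[OF q(2)] q(3) by auto
      then show "q = q'" by (rule cell_disjoint[OF d])
    qed
    show "x ` {q\<in>A. cell d q \<inter> P \<noteq> {}} \<subseteq> P" using x by auto
  qed
qed

lemma cell_measure:
  assumes "d > 0"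
  shows "integrable lborel (indicator (cell d q) :: real \<Rightarrow> real)" "measure lborel (cell d q) = d"
  using assms by (auto simp: cell_def algebra_simps intro!: integrable_real_indicator)

lemma mem_cell_floor: "d > 0 \<Longrightarrow> f \<in> cell d \<lfloor>f / d\<rfloor>"
  using floor_divide_lower[of d f] floor_divide_upper[of d f] by (simp add: cell_def)

text \<open>The active set takes finitely many values, each on a Borel set, so the function is a
  finite combination of indicators of sets of finite measure.\<close>

lemma integrable_indicator_mult_pattern:
  fixes h :: "nat set \<Rightarrow> real" and F :: "nat \<Rightarrow> real set"
  assumes F: "\<And>i. i < N \<Longrightarrow> F i \<in> sets borel" and fin: "\<And>i. i < N \<Longrightarrow> emeasure lborel (F i) < \<infinity>"
  shows "integrable lborel (\<lambda>f. indicator (\<Union>i<N. F i) f * h {i. i < N \<and> f \<in> F i})"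
proof -
  let ?I = "\<lambda>f. {i. i < N \<and> f \<in> F i}" and ?F = "\<Union>i<N. F i"
  have F': "?F \<in> sets borel" using F by auto
  have "emeasure lborel ?F \<le> (\<Sum>i<N. emeasure lborel (F i))"
    using F by (intro emeasure_subadditive_finite) auto
  also have "\<dots> < \<infinity>" using fin by simp
  finally have fin': "emeasure lborel ?F < \<infinity>" .
  have ind: "integrable lborel (indicator (?F \<inter> {f. ?I f = A}) :: real \<Rightarrow> real)" for A
  proof -
    have "{f. ?I f = A} \<in> sets borel"
    proof (cases "A \<subseteq> {..<N}")
      case True
      then have "{f. ?I f = A} = UNIV \<inter> (\<Inter>i\<in>{..<N}. if i \<in> A then F i else - F i)" by (auto split: if_splits)
      also have "\<dots> \<in> sets borel"
      \<comment> \<open>An empty intersection is the whole line, while closure under finite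
        intersections is applied with a nonempty index set.\<close>
      proof (cases "N = 0")
        case False
        have "(if i \<in> A then F i else - F i) \<in> sets borel" if "i < N" for i
          using F[OF that] by auto
        then have "(\<Inter>i\<in>{..<N}. if i \<in> A then F i else - F i) \<in> sets borel"
          using False by (intro sets.finite_INT) auto
        then show ?thesis by (simp only: Int_UNIV_left)
      qed simp
      finally show ?thesis .
    next
      case False
      then have "{f. ?I f = A} = {}" by auto
      then show ?thesis by simp
    qed
    then have m: "?F \<inter> {f. ?I f = A} \<in> sets lborel" using F' by auto
    have "emeasure lborel (?F \<inter> {f. ?I f = A}) \<le> emeasure lborel ?F"
      using F' by (intro emeasure_mono) auto
    then have "emeasure lborel (?F \<inter> {f. ?I f = A}) < \<infinity>" using fin' by (rule le_less_trans)
    then show ?thesis using m by (intro integrable_real_indicator)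
  qed
  have "indicator ?F f * h (?I f) = (\<Sum>A\<in>Pow {..<N}. h A * indicator (?F \<inter> {f. ?I f = A}) f)" for f
  proof -
    have "(\<Sum>A\<in>Pow {..<N}. h A * indicator (?F \<inter> {f. ?I f = A}) f)
        = (\<Sum>A\<in>Pow {..<N}. if A = ?I f then indicator ?F f * h (?I f) else 0)"
      by (intro sum.cong) (auto simp: indicator_def)
    also have "\<dots> = indicator ?F f * h (?I f)" by (auto simp: subset_eq)
    finally show ?thesis ..
  qed
  then have "(\<lambda>f. indicator ?F f * h (?I f)) = (\<lambda>f. \<Sum>A\<in>Pow {..<N}. h A * indicator (?F \<inter> {f. ?I f = A}) f)"
    by (rule ext)
  then show ?thesis by (simp only:) (intro Bochner_Integration.integrable_sum integrable_mult_right ind)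
qed

text \<open>Only the cells containing a jump point of some \<open>F i\<close> are lost, and their number does not
  depend on the mesh \<open>d\<close>.\<close>

lemma grid_approximation:
  fixes h :: "nat set \<Rightarrow> real" and F :: "nat \<Rightarrow> real set"
  assumes F: "\<And>i. i < N \<Longrightarrow> finite_union_of_intervals (F i)"
    and fin: "\<And>i. i < N \<Longrightarrow> emeasure lborel (F i) < \<infinity>"
    and h: "\<And>A. h A \<ge> 0" "h {} = 0"
  shows "\<exists>B\<ge>0. \<forall>d>0. \<exists>Q. finite Q \<and>
     (\<Sum>i<N. measure lborel (F i)) - (LINT f:(\<Union>i<N. F i)|lborel. h {i. i < N \<and> f \<in> F i})
       \<le> d * (\<Sum>q\<in>Q. real (card {i. i < N \<and> cell d q \<subseteq> F i}) - h {i. i < N \<and> cell d q \<subseteq> F i}) + B * d"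
proof -
  let ?I = "\<lambda>f. {i. i < N \<and> f \<in> F i}" and ?F = "\<Union>i<N. F i"
  have "\<exists>P. i < N \<longrightarrow> finite P \<and> (\<forall>x y. x \<le> y \<longrightarrow> {x..y} \<inter> P = {} \<longrightarrow> (x \<in> F i \<longleftrightarrow> y \<in> F i))" for i
    using finite_union_jump_points[OF F[of i]] by (cases "i < N") auto
  then have "\<exists>p. \<forall>i. i < N \<longrightarrow> finite (p i) \<and> (\<forall>x y. x \<le> y \<longrightarrow> {x..y} \<inter> p i = {} \<longrightarrow> (x \<in> F i \<longleftrightarrow> y \<in> F i))"
    by (intro choice allI)
  then obtain p where p0: "\<forall>i. i < N \<longrightarrow> finite (p i) \<and> (\<forall>x y. x \<le> y \<longrightarrow> {x..y} \<inter> p i = {} \<longrightarrow> (x \<in> F i \<longleftrightarrow> y \<in> F i))" ..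
  have p: "finite (p i)" "\<And>x y. x \<le> y \<Longrightarrow> {x..y} \<inter> p i = {} \<Longrightarrow> (x \<in> F i \<longleftrightarrow> y \<in> F i)" if "i < N" for i
    using p0[rule_format, OF that] by auto
  define P where "P = (\<Union>i<N. p i)"
  have P: "finite P" using p by (auto simp: P_def)
  have "bounded ?F" using finite_measure_union_bounded[OF F fin] by (intro bounded_UN) auto
  then obtain b where b: "\<And>f. f \<in> ?F \<Longrightarrow> \<bar>f\<bar> \<le> b" unfolding bounded_iff real_norm_def by blast
  have meas: "F i \<in> sets borel" if "i < N" for i using F[OF that] by (rule finite_union_borel)
  have intF: "integrable lborel (indicator (F i) :: real \<Rightarrow> real)" if "i < N" for i
    using meas[OF that] fin[OF that] by (intro integrable_real_indicator) auto
  show ?thesis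
  proof (intro exI[of _ "real N * real (card P)"] conjI allI impI)
    fix d :: real assume d: "d > 0"
    \<comment> \<open>All cells that can contain a frequency of the bounded union of the
      bands.\<close>
    define Q0 where "Q0 = {\<lfloor>- b / d\<rfloor>..\<lfloor>b / d\<rfloor>}"
    define bad where "bad = {q\<in>Q0. cell d q \<inter> P \<noteq> {}}"
    define Q where "Q = Q0 - bad"
    let ?act = "\<lambda>q. {i. i < N \<and> cell d q \<subseteq> F i}"
    let ?m = "\<lambda>q. real (card (?act q)) - h (?act q)"
    have "finite Q0" by (simp add: Q0_def)
    then have fQ: "finite Q" "finite bad" by (auto simp: Q_def bad_def)
    \<comment> \<open>No jump point separates two frequencies of a good cell, so they have the same
      active set.\<close>
    have const: "?I f = ?act q" if q: "q \<in> Q" and f: "f \<in> cell d q" for q f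
    proof -
      have np: "cell d q \<inter> P = {}" using q by (auto simp: Q_def bad_def)
      have "y \<in> F i" if i: "i < N" "f \<in> F i" and y: "y \<in> cell d q" for i y
      proof -
        have "{min f y..max f y} \<subseteq> cell d q" using f y by (auto simp: cell_def)
        then have "{min f y..max f y} \<inter> p i = {}" using np i by (auto simp: P_def)
        from p(2)[OF i(1) _ this] show ?thesis using i(2) by (cases "f \<le> y") (simp_all add: min_def max_def)
      qed
      then show ?thesis using f by auto
    qed
    \<comment> \<open>Inside the bands, good cells give equality, and on a bad cell the left side is
      at most \<open>N\<close> because \<open>h\<close> is nonnegative. Outside the bands the left
      side is 0, and a good cell contributes 0 because \<open>h {} = 0\<close>.\<close>
    have pointwise: "(\<Sum>i<N. indicator (F i) f) - indicator ?F f * h (?I f)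
        \<le> (\<Sum>q\<in>Q. ?m q * indicator (cell d q) f) + real N * (\<Sum>q\<in>bad. indicator (cell d q) f)" for f
    proof -
      have card: "(\<Sum>i<N. indicator (F i) f) = real (card (?I f))"
        by (simp add: indicator_def sum.If_cases) (rule arg_cong[of _ _ card], auto)
      have cardN: "real (card (?I f)) \<le> real N"
        using card_mono[of "{..<N}" "?I f"] by (auto simp: subset_eq)
      let ?q = "\<lfloor>f / d\<rfloor>"
      have only: "indicator (cell d q) f = (if q = ?q then 1 else 0 :: real)" for q
      proof (cases "q = ?q")
        case True
        then show ?thesis using mem_cell_floor[OF d, of f] by simp
      next
        case False
        then have "f \<notin> cell d q" using cell_disjoint[OF d mem_cell_floor[OF d, of f], of q] by auto
        then show ?thesis using False by simp
      qed
      have sums: "(\<Sum>q\<in>A. g q * indicator (cell d q) f) = (if ?q \<in> A then g ?q else 0)"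
        if "finite A" for A and g :: "int \<Rightarrow> real"
      proof -
        have "(\<Sum>q\<in>A. g q * indicator (cell d q) f) = (\<Sum>q\<in>A. if q = ?q then g ?q else 0)"
          by (intro sum.cong) (auto simp: only)
        then show ?thesis using that by simp
      qed
      have bads: "(\<Sum>q\<in>bad. indicator (cell d q) f) = (if ?q \<in> bad then 1 else 0 :: real)"
        using sums[OF fQ(2), of "\<lambda>_. 1"] by simp
      show ?thesis
      proof (cases "f \<in> ?F")
        case False
        then have "?I f = {}" by auto
        have "0 \<le> (\<Sum>q\<in>Q. ?m q * indicator (cell d q) f)"
        proof (cases "?q \<in> Q")
          case True
          have "?act ?q = {}" using const[OF True mem_cell_floor[OF d]] \<open>?I f = {}\<close> by simp
          then have "?m ?q = 0" by (simp only: h(2)) simp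
          with sums[OF fQ(1), of ?m] True show ?thesis by (simp only: if_True order_refl)
        qed (simp add: sums[OF fQ(1)])
        then show ?thesis using False \<open>?I f = {}\<close> by (simp add: card bads)
      next
        case True
        then have bf: "\<bar>f\<bar> \<le> b" by (rule b)
        have "- b / d \<le> f / d" "f / d \<le> b / d"
          using d bf by (intro divide_right_mono; linarith)+
        then have "?q \<in> Q0" by (auto simp: Q0_def intro!: floor_mono)
        then consider "?q \<in> Q" "?q \<notin> bad" | "?q \<notin> Q" "?q \<in> bad" by (auto simp: Q_def)
        then show ?thesis
        proof cases
          case 1
          have "?I f = ?act ?q" by (rule const[OF 1(1) mem_cell_floor[OF d]])
          then show ?thesis using True 1 by (simp add: card bads sums[OF fQ(1)])
        next
          case 2
          then show ?thesis using True h(1)[of "?I f"] cardN by (simp add: card bads sums[OF fQ(1)])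
        qed
      qed
    qed
    have intH: "integrable lborel (\<lambda>f. indicator ?F f * h (?I f))"
      by (rule integrable_indicator_mult_pattern[OF meas fin])
    have "(\<Sum>i<N. measure lborel (F i)) - (LINT f:?F|lborel. h (?I f))
       = (LINT f|lborel. (\<Sum>i<N. indicator (F i) f) - indicator ?F f * h (?I f))"
    proof -
      have "(LINT f|lborel. (\<Sum>i<N. indicator (F i) f) - indicator ?F f * h (?I f)) =
          (LINT f|lborel. (\<Sum>i<N. indicator (F i) f)) - (LINT f|lborel. indicator ?F f * h (?I f))"
        by (intro Bochner_Integration.integral_diff Bochner_Integration.integrable_sum intF intH) simp
      also have "(LINT f|lborel. (\<Sum>i<N. indicator (F i) f)) = (\<Sum>i<N. measure lborel (F i))"
        using intF by (subst Bochner_Integration.integral_sum) auto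
      finally show ?thesis by (simp add: set_lebesgue_integral_def)
    qed
    also have "\<dots> \<le> (LINT f|lborel. (\<Sum>q\<in>Q. ?m q * indicator (cell d q) f) + real N * (\<Sum>q\<in>bad. indicator (cell d q) f))"
    proof (rule integral_mono)
      show "integrable lborel (\<lambda>f. (\<Sum>i<N. indicator (F i) f) - indicator ?F f * h (?I f))"
        by (intro Bochner_Integration.integrable_diff Bochner_Integration.integrable_sum intF intH) simp
    qed (use cell_measure[OF d] pointwise in auto)
    also have "\<dots> = (\<Sum>q\<in>Q. ?m q * d) + real N * (\<Sum>q\<in>bad. d)"
      using cell_measure[OF d]
      by (simp add: Bochner_Integration.integral_add Bochner_Integration.integral_sum)
    also have "\<dots> \<le> d * (\<Sum>q\<in>Q. ?m q) + real N * real (card P) * d"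
    proof -
      have "real (card bad) \<le> real (card P)" unfolding bad_def using card_cells_meeting_le[OF d P] by simp
      then have "real N * (real (card bad) * d) \<le> real N * (real (card P) * d)"
        using d by (intro mult_left_mono mult_right_mono) auto
      then show ?thesis by (simp add: sum_distrib_left mult.commute mult.left_commute)
    qed
    finally show "\<exists>Q. finite Q \<and> (\<Sum>i<N. measure lborel (F i)) - (LINT f:?F|lborel. h (?I f))
       \<le> d * (\<Sum>q\<in>Q. ?m q) + real N * real (card P) * d" using fQ(1) by blast
  qed simp
qed

section \<open>From sample counts to the lower density\<close>

lemma mat_rank_Usub_empty:
  assumes "V \<subseteq> {..<N}"
  shows "mat_rank (Usub N U V {}) = 0"
proof -
  have "Usub N U V {} \<in> carrier_mat (card V) 0" using Usub_dims[OF assms, of "{}"] by simp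
  from vec_space.rank_le_nc[OF this] this show ?thesis by (simp add: mat_rank_def)
qed

theorem theorem1:
  fixes N :: nat
    and W :: "nat \<Rightarrow> nat \<Rightarrow> real"
    and U :: "nat \<Rightarrow> nat \<Rightarrow> complex"
    and lam :: "nat \<Rightarrow> real"
    and F :: "nat \<Rightarrow> real set"
    and S' :: "nat set"
    and S :: "(nat \<times> real) set"
    and \<Theta> :: "nat set"
  assumes N_pos: "N > 0"
    and graph: "undirected_weighted_graph N W"
    and eig: "laplacian_eigendecomp N W U lam"
    and F_intervals: "\<forall>i<N. finite_union_of_intervals (F i)"
    and F_finite: "\<forall>i<N. emeasure lborel (F i) < \<infinity>"
    and S'_sub: "S' \<subseteq> {..<N}"
    and S'_card: "card S' = card {i. i < N \<and> F i \<noteq> {}}"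
    and S'_rank: "mat_rank (Usub N U S' {i. i < N \<and> F i \<noteq> {}}) = card {i. i < N \<and> F i \<noteq> {}}"
    and S_sub: "S \<subseteq> S' \<times> UNIV"
    and S_stable: "stable_sampling S S' (BL_C N U F)"
    and Theta_sub: "\<Theta> \<subseteq> S'"
  shows "density N {(v, t) \<in> S. v \<in> \<Theta>} \<ge>
           ereal ((1 / real N) *
             ((\<Sum>i<N. measure lborel (F i)) -
              (LINT f:(\<Union>i<N. F i)|lborel.
                 real (mat_rank (Usub N U (S' - \<Theta>) {i. i < N \<and> f \<in> F i})))))"
proof -
  define h where "h A = real (mat_rank (Usub N U (S' - \<Theta>) A))" for A
  define D where "D = (\<Sum>i<N. measure lborel (F i)) - (LINT f:(\<Union>i<N. F i)|lborel. h {i. i < N \<and> f \<in> F i})"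
  define n where "n T = real (card {(v, t)\<in>S. v \<in> \<Theta> \<and> \<bar>t\<bar> \<le> T})" for T
  have h0: "h {} = 0" unfolding h_def using S'_sub by (subst mat_rank_Usub_empty) auto
  have "\<exists>B\<ge>0. \<forall>d>0. \<exists>Q. finite Q \<and>
     (\<Sum>i<N. measure lborel (F i)) - (LINT f:(\<Union>i<N. F i)|lborel. h {i. i < N \<and> f \<in> F i})
       \<le> d * (\<Sum>q\<in>Q. real (card {i. i < N \<and> cell d q \<subseteq> F i}) - h {i. i < N \<and> cell d q \<subseteq> F i}) + B * d"
    by (rule grid_approximation) (use F_intervals F_finite h0 in \<open>auto simp: h_def\<close>)
  then obtain B where B: "B \<ge> 0" "\<And>d. d > 0 \<Longrightarrow> \<exists>Q. finite Q \<and>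
     D \<le> d * (\<Sum>q\<in>Q. real (card {i. i < N \<and> cell d q \<subseteq> F i}) - h {i. i < N \<and> cell d q \<subseteq> F i}) + B * d"
    unfolding D_def by blast
  have count: "\<forall>\<^sub>F T in at_top. 2 * T * E < n T" if E: "0 \<le> E" "E < D" for E
  proof -
    \<comment> \<open>So fine that the grid error \<open>B * d\<close> uses at most half of the gap
      \<open>D - E\<close>, which leaves \<open>E < d * m\<close>. The added 1 avoids a division by
      0.\<close>
    define d where "d = (D - E) / (2 * (B + 1))"
    have d: "d > 0" using E B(1) by (simp add: d_def)
    obtain Q where fQ: "finite Q" and
      Q: "D \<le> d * (\<Sum>q\<in>Q. real (card {i. i < N \<and> cell d q \<subseteq> F i}) - h {i. i < N \<and> cell d q \<subseteq> F i}) + B * d"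
      using B(2)[OF d] by blast
    define m where "m = (\<Sum>q\<in>Q. real (card {i. i < N \<and> cell d q \<subseteq> F i}) - h {i. i < N \<and> cell d q \<subseteq> F i})"
    have "B * d \<le> (B + 1) * d" using d by (intro mult_right_mono) auto
    also have "(B + 1) * d = (D - E) / 2" using B(1) by (simp add: d_def field_simps)
    finally have dm: "E < d * m" using Q E by (simp add: m_def)
    have m: "m > 0"
      using dm E d by (metis less_le_trans mult_nonneg_nonpos not_le order_le_less_trans less_imp_le)
    \<comment> \<open>\<open>x\<close> is the ratio that the construction must exceed. The loss
      factor \<open>w\<close> enters twice, as \<open>l / d\<close> and as the share of
      \<open>[-T, T]\<close> that holds the centres; its choice as the midpoint of \<open>x\<close>
      and 1 makes \<open>w^2 > x\<close>.\<close>
    define x where "x = E / (d * m)"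
    have x: "0 \<le> x" "x < 1" using dm E by (simp_all add: x_def)
    define w where "w = (1 + x) / 2"
    have w: "0 < w" "w < 1" using x by (simp_all add: w_def)
    have "w\<^sup>2 - x = ((1 - x) / 2)\<^sup>2" by (simp add: w_def power2_eq_square field_simps)
    also have "\<dots> > 0" using x by simp
    finally have wx: "x < w\<^sup>2" by simp
    have gap: "0 < w\<^sup>2 * (d * m) - E"
    proof -
      have "x * (d * m) < w\<^sup>2 * (d * m)" using wx d m by (intro mult_strict_right_mono) auto
      then show ?thesis using d m by (simp add: x_def)
    qed
    define l where "l = w * d"
    have l: "0 < l" "l < d" using w d by (simp_all add: l_def)
    interpret cell_grid N U F d l Q
      using l fQ F_intervals by unfold_locales (auto intro: finite_union_borel)
    obtain g where g: "g > 0" "\<And>K T R. finite K \<Longrightarrow> R > 0 \<Longrightarrow>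
       (\<forall>k\<in>K. \<forall>t. T < \<bar>t\<bar> \<longrightarrow> R \<le> \<bar>t - real_of_int k / l\<bar>) \<Longrightarrow> real (card K) < g * R\<^sup>2 \<Longrightarrow>
       card K * (\<Sum>q\<in>Q. card (act q)) \<le>
         card {(v, t)\<in>S. v \<in> \<Theta> \<and> \<bar>t\<bar> \<le> T} + card K * (\<Sum>q\<in>Q. mat_rank (Usub N U (S' - \<Theta>) (act q)))"
      using sample_count[OF S'_sub Theta_sub S'_card S'_rank S_sub S_stable] by blast
    \<comment> \<open>The second bound on \<open>T\<close> absorbs the rounding in the number of
      centres. The third makes \<open>card K\<close>, which is linear in \<open>T\<close>, smaller
      than the quadratic \<open>g * R^2\<close> with \<open>R = (1 - w) * T\<close>.\<close>
    have "2 * T * E < n T"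
      if T: "1 < T" "m / (2 * (w\<^sup>2 * (d * m) - E)) < T" "(2 * w * l + 1) / (g * (1 - w)\<^sup>2) < T" for T
    proof -
      \<comment> \<open>The largest shift with \<open>M / l <= w * T\<close>, so that all centres
        lie in \<open>[-w * T, w * T]\<close>.\<close>
      define M where "M = \<lfloor>w * T * l\<rfloor>"
      define K where "K = {- M..M}"
      have M: "0 \<le> M" "real_of_int M \<le> w * T * l" "w * T * l - 1 < real_of_int M"
        using w T l by (auto simp: M_def)
      have cardK: "real (card K) = 2 * real_of_int M + 1" using M(1) by (simp add: K_def)
      have R: "(1 - w) * T > 0" using w T by simp
      have far: "\<forall>k\<in>K. \<forall>t. T < \<bar>t\<bar> \<longrightarrow> (1 - w) * T \<le> \<bar>t - real_of_int k / l\<bar>"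
      proof (intro ballI allI impI)
        fix k t assume k: "k \<in> K" and t: "T < \<bar>t\<bar>"
        have "\<bar>real_of_int k\<bar> \<le> real_of_int M" using k by (auto simp: K_def)
        then have "\<bar>real_of_int k\<bar> \<le> w * T * l" using M by linarith
        then have "\<bar>real_of_int k / l\<bar> \<le> w * T" using l by (simp add: abs_divide field_simps)
        then have "T - w * T \<le> \<bar>t - real_of_int k / l\<bar>" using t by linarith
        then show "(1 - w) * T \<le> \<bar>t - real_of_int k / l\<bar>" by (simp only: left_diff_distrib mult_1)
      qed
      have small: "real (card K) < g * ((1 - w) * T)\<^sup>2"
      proof -
        have "real (card K) \<le> 2 * w * l * T + 1 * 1" using cardK M by (simp add: mult_ac)
        also have "\<dots> \<le> (2 * w * l + 1) * T" using T by (simp add: algebra_simps)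
        also have "2 * w * l + 1 < T * (g * (1 - w)\<^sup>2)"
          using T(3) g w by (simp add: pos_divide_less_eq)
        then have "(2 * w * l + 1) * T < T * (g * (1 - w)\<^sup>2) * T" using T by (intro mult_strict_right_mono) auto
        also have "\<dots> = g * ((1 - w) * T)\<^sup>2" by (simp add: power2_eq_square mult_ac)
        finally show ?thesis .
      qed
      have "finite K" by (simp add: K_def)
      from g(2)[OF this R far small] have
        "real (card K * (\<Sum>q\<in>Q. card (act q))) \<le>
          real (card {(v, t)\<in>S. v \<in> \<Theta> \<and> \<bar>t\<bar> \<le> T} + card K * (\<Sum>q\<in>Q. mat_rank (Usub N U (S' - \<Theta>) (act q))))"
        by (rule of_nat_mono)
      then have "real (card K) * m \<le> n T"
        by (simp add: n_def m_def h_def act_def sum_subtractf right_diff_distrib)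
      \<comment> \<open>The floor loses less than 1, and \<open>K\<close> has
        \<open>2 * M + 1\<close> elements.\<close>
      moreover have "(2 * (w * T * l) - 1) * m \<le> real (card K) * m"
        using M m cardK by (intro mult_right_mono) auto
      moreover have "2 * T * E < (2 * (w * T * l) - 1) * m"
      proof -
        have "m < T * (2 * (w\<^sup>2 * (d * m) - E))" using T(2) gap by (simp add: pos_divide_less_eq)
        then show ?thesis by (simp add: l_def power2_eq_square algebra_simps)
      qed
      ultimately show ?thesis by linarith
    qed
    then show ?thesis
      by (intro eventually_mono[OF eventually_conj[OF eventually_gt_at_top[of 1] eventually_conj[OF
          eventually_gt_at_top[of "m / (2 * (w\<^sup>2 * (d * m) - E))"]
          eventually_gt_at_top[of "(2 * w * l + 1) / (g * (1 - w)\<^sup>2)"]]]]) auto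
  qed
  have set_eq: "{(v, t) \<in> {(v, t) \<in> S. v \<in> \<Theta>}. v < N \<and> - T \<le> t \<and> t \<le> T} = {(v, t)\<in>S. v \<in> \<Theta> \<and> \<bar>t\<bar> \<le> T}" for T
    using S'_sub Theta_sub by auto
  \<comment> \<open>A lower limit is at least a given value if every smaller level is eventually
    exceeded. Negative levels are exceeded since counts are nonnegative; a level
    \<open>z \<ge> 0\<close> is handled by \<open>count\<close> with
    \<open>E = z * N\<close>.\<close>
  have "ereal (1 / real N * D) \<le> density N {(v, t) \<in> S. v \<in> \<Theta>}"
    unfolding density_def set_eq n_def[symmetric] le_Liminf_iff
  proof (intro allI impI)
    fix y assume y: "y < ereal (1 / real N * D)"
    show "\<forall>\<^sub>F T in at_top. y < ereal (n T / (2 * T * real N))"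
    proof (cases y)
      case (real z)
      show ?thesis
      proof (cases "z < 0")
        case True
        have "\<forall>\<^sub>F T in at_top. (0 :: real) < T" by (rule eventually_gt_at_top)
        then show ?thesis
        proof eventually_elim
          case (elim T)
          then have "0 \<le> n T / (2 * T * real N)" by (simp add: n_def)
          then show ?case using True real by (simp del: times_divide_eq_left)
        qed
      next
        case False
        have "z * real N < D" using y real N_pos by (simp add: field_simps)
        then have "\<forall>\<^sub>F T in at_top. 2 * T * (z * real N) < n T" using False by (intro count) auto
        then show ?thesis using eventually_gt_at_top[of 0]
        proof eventually_elim
          case (elim T)
          then have "z < n T / (2 * T * real N)" using N_pos by (simp add: field_simps)
          then show ?case by (simp add: real)
        qed
      qed
    qed (use y in auto)
  qed
  then show ?thesis by (simp only: D_def h_def)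
qed

end
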